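(* Let $\Phi:[0,\infty]\to[0,\infty]$ be a Young function such that $\Phi\in\Delta_2$, and let $\widetilde\Phi$ be its complementary function. Then $$L^{\Phi,1}(\mathbb{R}^n)^\ast={\rm w}L^{\widetilde\Phi}(\mathbb{R}^n)$$ with equivalence of quasi-norms. That is, for every $g\in{\rm w}L^{\widetilde\Phi}(\mathbb{R}^n)$ the map $T_g:f\mapsto\int_{\mathbb{R}^n}f(x)g(x)\,dx$ is a well-defined bounded linear functional on $L^{\Phi,1}(\mathbb{R}^n)$; every bounded linear functional on $L^{\Phi,1}(\mathbb{R}^n)$ equals $T_g$ for a unique (up to a.e. equality) $g\in{\rm w}L^{\widetilde\Phi}(\mathbb{R}^n)$; and there is a constant $C\ge1$, independent of $g$, such that $C^{-1}\|g\|_{{\rm w}L^{\widetilde\Phi}}\le\|T_g\|_{(L^{\Phi,1})^\ast}\le C\|g\|_{{\rm w}L^{\widetilde\Phi}}$.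
   Context: For $\Phi:[0,\infty]\to[0,\infty]$ put $a(\Phi)=\sup\{t\ge0:\Phi(t)=0\}$ and $b(\Phi)=\inf\{t\ge0:\Phi(t)=\infty\}$, with $\inf\emptyset=\infty$. An increasing (i.e. non-decreasing) function $\Phi:[0,\infty]\to[0,\infty]$ is a Young function if: (1) $0\le a(\Phi)<\infty$ and $0<b(\Phi)\le\infty$; (2) $\lim_{t\to0}\Phi(t)=\Phi(0)=0$; (3) $\Phi$ is convex on $[0,b(\Phi))$; (4) if $b(\Phi)=\infty$ then $\lim_{t\to\infty}\Phi(t)=\Phi(\infty)=\infty$; (5) if $b(\Phi)<\infty$ then $\lim_{t\to b(\Phi)-0}\Phi(t)=\Phi(b(\Phi))$. $\Phi\in\Delta_2$ means that for some $k>1$, $\Phi(2r)\le k\Phi(r)$ for all $r>0$. The generalized inverse is $\Phi^{-1}(u)=\inf\{t\ge0:\Phi(t)>u\}$ for $u\in[0,\infty)$ and $\Phi^{-1}(\infty)=\infty$; $\Phi^{-1}(u)^{-1}$ denotes the reciprocal $1/\Phi^{-1}(u)$. The complementary function is $\widetilde\Phi(r)=\sup\{rs-\Phi(s):s\in[0,\infty)\}$ for $r\in[0,\infty)$, $\widetilde\Phi(\infty)=\infty$; it is again a Young function. $L^0(\mathbb{R}^n)$ is the set of (complex-valued) measurable functions on $\mathbb{R}^n$, modulo a.e. equality. For $f\in L^0(\mathbb{R}^n)$ and $t>0$, $m(f,t)=|\{x\in\mathbb{R}^n:|f(x)|>t\}|$ and $f^\ast(t)=\inf\{\alpha>0:m(f,\alpha)\le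 t\}$ (with $\inf\emptyset=\infty$). $L^{\Phi,1}(\mathbb{R}^n)$ is the set of all measurable $f$ with $\|f\|_{L^{\Phi,1}}=\int_0^\infty\Phi^{-1}(1/t)^{-1}f^\ast(t)\,\frac{dt}{t}<\infty$. For a Young function $\Psi$, ${\rm w}L^\Psi(\mathbb{R}^n)$ is the set of $f\in L^0(\mathbb{R}^n)$ with $\sup_{t>0}\Psi(t)m(kf,t)<\infty$ for some $k>0$, and $\|f\|_{{\rm w}L^\Psi}=\inf\{\lambda>0:\sup_{t>0}\Psi(t)m(f/\lambda,t)\le1\}$ (convention $0\cdot\infty=0$). The dual $L^{\Phi,1}(\mathbb{R}^n)^\ast$ is the space of linear functionals $T$ with $\|T\|_{(L^{\Phi,1})^\ast}=\sup\{|T(f)|:\|f\|_{L^{\Phi,1}}\le1\}<\infty$. *)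

theory Defs
  imports "HOL-Analysis.Analysis"
begin

section \<open>Young functions\<close>

text \<open>The extended half line \<open>[0,\<infinity>]\<close> is the type \<^typ>\<open>ennreal\<close>.  Its arithmetic follows the usual
  conventions: \<open>0 * \<infinity> = 0\<close>, \<open>inverse 0 = \<infinity>\<close>, \<open>inverse \<infinity> = 0\<close>, \<open>Inf {} = \<infinity>\<close>.\<close>

definition young_a :: "(ennreal \<Rightarrow> ennreal) \<Rightarrow> ennreal"
  where "young_a \<Phi> = Sup {t. \<Phi> t = 0}"

definition young_b :: "(ennreal \<Rightarrow> ennreal) \<Rightarrow> ennreal"
  where "young_b \<Phi> = Inf {t. \<Phi> t = \<infinity>}"

text \<open>Convexity is spelled out because \<^typ>\<open>ennreal\<close> is not a real vector space, so the
  library's \<open>convex_on\<close> does not apply.  In \<^typ>\<open>ennreal\<close>, \<open>at 0\<close> and \<open>at \<infinity>\<close> are the one-sided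
  filters for \<open>t \<rightarrow> 0\<close> and \<open>t \<rightarrow> \<infinity>\<close>.\<close>

definition young_function :: "(ennreal \<Rightarrow> ennreal) \<Rightarrow> bool"
  where "young_function \<Phi> \<longleftrightarrow>
     mono \<Phi> \<and>
     young_a \<Phi> < \<infinity> \<and> 0 < young_b \<Phi> \<and>
     (\<Phi> \<longlongrightarrow> 0) (at 0) \<and> \<Phi> 0 = 0 \<and>
     (\<forall>x < young_b \<Phi>. \<forall>y < young_b \<Phi>. \<forall>u \<in> {0..1::real}.
        \<Phi> (ennreal u * x + ennreal (1 - u) * y) \<le> ennreal u * \<Phi> x + ennreal (1 - u) * \<Phi> y) \<and>
     (young_b \<Phi> = \<infinity> \<longrightarrow> (\<Phi> \<longlongrightarrow> \<infinity>) (at \<infinity>) \<and> \<Phi> \<infinity> = \<infinity>) \<and>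
     (young_b \<Phi> < \<infinity> \<longrightarrow> (\<Phi> \<longlongrightarrow> \<Phi> (young_b \<Phi>)) (at_left (young_b \<Phi>)))"

definition Delta2 :: "(ennreal \<Rightarrow> ennreal) \<Rightarrow> bool"
  where "Delta2 \<Phi> \<longleftrightarrow> (\<exists>k::real. k > 1 \<and> (\<forall>r > 0. \<Phi> (2 * r) \<le> ennreal k * \<Phi> r))"

definition gen_inverse :: "(ennreal \<Rightarrow> ennreal) \<Rightarrow> ennreal \<Rightarrow> ennreal"
  where "gen_inverse \<Phi> u = (if u = \<infinity> then \<infinity> else Inf {t. \<Phi> t > u})"

text \<open>Subtraction on \<^typ>\<open>ennreal\<close> is truncated at \<open>0\<close>.  For a Young function this does not change
  the supremum, since \<open>s = 0\<close> already contributes the value \<open>0\<close>.\<close>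

definition complementary :: "(ennreal \<Rightarrow> ennreal) \<Rightarrow> ennreal \<Rightarrow> ennreal"
  where "complementary \<Phi> r =
     (if r = \<infinity> then \<infinity> else (SUP s \<in> {s. s < \<infinity>}. r * s - \<Phi> s))"

section \<open>Function spaces\<close>

text \<open>Elements of \<open>L\<^sup>0\<close> are represented by complex-valued Lebesgue measurable functions; the passage
  to classes modulo a.e. equality is made explicit where it matters (functionals respect a.e.
  equality, uniqueness holds up to a.e. equality).\<close>

definition distr_fun :: "(real ^ 'n \<Rightarrow> complex) \<Rightarrow> real \<Rightarrow> ennreal"
  where "distr_fun f t = emeasure lebesgue {x. cmod (f x) > t}"

definition rearrangement :: "(real ^ 'n \<Rightarrow> complex) \<Rightarrow> real \<Rightarrow> ennreal"
  where "rearrangement f t = (INF \<alpha> \<in> {\<alpha>::real. \<alpha> > 0 \<and> distr_fun f \<alpha> \<le> ennreal t}. ennreal \<alpha>)"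

definition LPhi1_norm :: "(ennreal \<Rightarrow> ennreal) \<Rightarrow> (real ^ 'n \<Rightarrow> complex) \<Rightarrow> ennreal"
  where "LPhi1_norm \<Phi> f =
     (\<integral>\<^sup>+ t \<in> {0<..}.
        inverse (gen_inverse \<Phi> (ennreal (1 / t))) * rearrangement f t * ennreal (1 / t) \<partial>lborel)"

definition LPhi1 :: "(ennreal \<Rightarrow> ennreal) \<Rightarrow> (real ^ 'n \<Rightarrow> complex) set"
  where "LPhi1 \<Phi> = {f \<in> borel_measurable lebesgue. LPhi1_norm \<Phi> f < \<infinity>}"

definition weak_modular :: "(ennreal \<Rightarrow> ennreal) \<Rightarrow> (real ^ 'n \<Rightarrow> complex) \<Rightarrow> ennreal"
  where "weak_modular \<Psi> f = (SUP t \<in> {0::real<..}. \<Psi> (ennreal t) * distr_fun f t)"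

definition wL :: "(ennreal \<Rightarrow> ennreal) \<Rightarrow> (real ^ 'n \<Rightarrow> complex) set"
  where "wL \<Psi> = {f \<in> borel_measurable lebesgue.
     \<exists>k::real. k > 0 \<and> weak_modular \<Psi> (\<lambda>x. of_real k * f x) < \<infinity>}"

definition wL_norm :: "(ennreal \<Rightarrow> ennreal) \<Rightarrow> (real ^ 'n \<Rightarrow> complex) \<Rightarrow> ennreal"
  where "wL_norm \<Psi> f =
     (INF l \<in> {l::real. l > 0 \<and> weak_modular \<Psi> (\<lambda>x. f x / of_real l) \<le> 1}. ennreal l)"

section \<open>The dual space\<close>

text \<open>A functional on classes is a map on representatives that respects a.e. equality; its values
  outside \<open>LPhi1 \<Phi>\<close> are irrelevant.\<close>

definition LPhi1_linear_functional ::
    "(ennreal \<Rightarrow> ennreal) \<Rightarrow> ((real ^ 'n \<Rightarrow> complex) \<Rightarrow> complex) \<Rightarrow> bool"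
  where "LPhi1_linear_functional \<Phi> T \<longleftrightarrow>
     (\<forall>f \<in> LPhi1 \<Phi>. \<forall>h \<in> LPhi1 \<Phi>. (AE x in lebesgue. f x = h x) \<longrightarrow> T f = T h) \<and>
     (\<forall>f \<in> LPhi1 \<Phi>. \<forall>h \<in> LPhi1 \<Phi>. T (\<lambda>x. f x + h x) = T f + T h) \<and>
     (\<forall>c. \<forall>f \<in> LPhi1 \<Phi>. T (\<lambda>x. c * f x) = c * T f)"

definition dual_norm ::
    "(ennreal \<Rightarrow> ennreal) \<Rightarrow> ((real ^ 'n \<Rightarrow> complex) \<Rightarrow> complex) \<Rightarrow> ennreal"
  where "dual_norm \<Phi> T = (SUP f \<in> {f \<in> LPhi1 \<Phi>. LPhi1_norm \<Phi> f \<le> 1}. ennreal (cmod (T f)))"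

definition LPhi1_dual ::
    "(ennreal \<Rightarrow> ennreal) \<Rightarrow> ((real ^ 'n \<Rightarrow> complex) \<Rightarrow> complex) set"
  where "LPhi1_dual \<Phi> = {T. LPhi1_linear_functional \<Phi> T \<and> dual_norm \<Phi> T < \<infinity>}"

definition int_functional ::
    "(real ^ 'n \<Rightarrow> complex) \<Rightarrow> (real ^ 'n \<Rightarrow> complex) \<Rightarrow> complex"
  where "int_functional g f = (LINT x|lebesgue. f x * g x)"

end

theory Submission
  imports Defs
begin

text \<open>
  The doubling condition forces \<open>\<Phi>\<close> to be a strictly increasing bijection of \<open>[0,\<infinity>)\<close>, so that
  \<open>\<phi>(t) = 1 / \<Phi>\<^sup>-\<^sup>1(1/t)\<close> satisfies \<open>\<phi>(t/k) \<le> \<phi>(t)/2\<close>.  With the decreasing weight \<open>w(t) = \<phi>(t)/t\<close> and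
  \<open>W(t) = \<integral>\<^sub>0\<^sup>t w\<close> this gives \<open>\<phi> \<le> W \<le> k \<phi>\<close>, and \<open>\<parallel>f\<parallel> = \<integral> w f\<^sup>* = \<integral>\<^sub>0\<^sup>\<infinity> W(m(f,a)) da\<close>.

  Young's inequality turns \<open>\<parallel>g\<parallel> \<le> \<lambda>\<close> in the weak space into \<open>g\<^sup>* \<le> 2 \<lambda> w\<close>, and the Hardy--Littlewood
  inequality bounds \<open>T\<^sub>g\<close>.  Conversely, a bounded functional \<open>T\<close> defines the countably additive
  set function \<open>E \<mapsto> T(p \<chi>\<^sub>E)\<close> for a fixed strictly positive \<open>p\<close> in \<open>L\<^sup>\<Phi>\<^sup>1\<close>; its density divided by
  \<open>p\<close> represents \<open>T\<close>.  Testing on \<open>\<chi>\<^sub>E cnj (sgn g)\<close> for superlevel sets \<open>E\<close> of \<open>|g|\<close> gives the weak type bound.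
\<close>

section \<open>Rearrangements\<close>

text \<open>The factor \<open>p\<close> is there because the indicator of a set of infinite measure
  has infinite norm, while \<open>p * u\<close> lies in the space for every bounded
  \<open>u\<close>. The density is then a single integrable function on the whole space, and no
  local densities have to be glued. The complementary function may vanish near 0 and may jump to
  infinity (\<open>\<Phi> t = t\<close> gives the essentially bounded functions as dual), so it is
  never inverted. Only two comparisons with 1/s enter: its value at \<open>2 * w s\<close> is at
  least 1/s, and its values up to \<open>w s\<close> are at most 1/s. The 2 in the first is the
  constant of the upper dual bound; the k in the lower one comes from
  \<open>W \<le> k \<phi>\<close>. The formula with \<open>W\<close> is what makes limits
  accessible: \<open>W\<close> is finite at finite arguments, tends to 0 at 0 and is infinite at
  infinity. This gives dominated convergence in norm, from which both the countable additivity of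
  the set function and the passage from bounded to general functions follow.\<close>

declare emeasure_completion [simp del]

lemma sigma_finite_lebesgue: "sigma_finite_measure (lebesgue :: 'a::euclidean_space measure)"
proof
  obtain A :: "nat \<Rightarrow> 'a set" where A: "range A \<subseteq> sets lborel" "(\<Union>i. A i) = space lborel"
    "\<And>i. emeasure lborel (A i) \<noteq> \<infinity>"
    using lborel.sigma_finite by metis
  then have "emeasure lebesgue (A i) \<noteq> \<infinity>" for i
    by (metis emeasure_completion main_part_sets range_subsetD main_part sets_completionI_sets)
  with A show "\<exists>A :: 'a set set. countable A \<and> A \<subseteq> sets lebesgue \<and> \<Union> A = space lebesgue \<and>
      (\<forall>a\<in>A. emeasure lebesgue a \<noteq> \<infinity>)"
    by - (rule exI[of _ "range A"], auto simp: image_subset_iff)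
qed

lemma sets_distr_fun [measurable]:
  fixes f :: "'a::euclidean_space \<Rightarrow> complex"
  assumes [measurable]: "f \<in> borel_measurable lebesgue"
  shows "{x. t < cmod (f x)} \<in> sets lebesgue"
proof -
  have "{x \<in> space lebesgue. t < cmod (f x)} \<in> sets lebesgue"
    by measurable
  then show ?thesis by simp
qed

lemma distr_fun_antimono:
  assumes [measurable]: "f \<in> borel_measurable lebesgue" and "s \<le> t"
  shows "distr_fun f t \<le> distr_fun f s"
  unfolding distr_fun_def using assms(2) by (intro emeasure_mono) auto

lemma distr_fun_divide:
  assumes "0 < l"
  shows "distr_fun (\<lambda>x. g x / complex_of_real l) t = distr_fun g (l * t)"
  unfolding distr_fun_def using assms by (simp add: norm_divide pos_less_divide_eq mult.commute)

lemma borel_measurable_distr_fun [measurable]: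
  assumes [measurable]: "f \<in> borel_measurable lebesgue"
  shows "distr_fun f \<in> borel_measurable borel"
proof -
  interpret sigma_finite_measure "lebesgue :: (real ^ 'a) measure"
    by (rule sigma_finite_lebesgue)
  have 1: "distr_fun f t = (\<integral>\<^sup>+x. indicator {x. t < cmod (f x)} x \<partial>lebesgue)" for t
    unfolding distr_fun_def by (rule nn_integral_indicator[symmetric]) measurable
  have eq: "distr_fun f = (\<lambda>t. \<integral>\<^sup>+x. indicator {t<..} (cmod (f x)) \<partial>lebesgue)"
    unfolding 1 fun_eq_iff by (intro allI nn_integral_cong) (auto simp: indicator_def)
  have "(\<lambda>(t, x). indicator {t<..} (cmod (f x)) :: ennreal) =
     indicator {z \<in> space (borel \<Otimes>\<^sub>M lebesgue). fst z < cmod (f (snd z))}"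
    by (auto simp: indicator_def space_pair_measure)
  also have "\<dots> \<in> borel_measurable (borel \<Otimes>\<^sub>M lebesgue)"
    by measurable
  finally show ?thesis
    unfolding eq by measurable
qed

text \<open>Since \<open>distr_fun f\<close> decreases, the levels \<open>a > 0\<close> whose
  superlevel set has measure above \<open>s\<close> fill an interval starting at 0 and ending at the
  rearrangement. Writing the infimum as an integral of an indicator opens it to Fubini's
  theorem.\<close>

lemma rearrangement_eq:
  fixes s :: real
  assumes [measurable]: "f \<in> borel_measurable lebesgue"
  shows "rearrangement f s = (\<integral>\<^sup>+a\<in>{0<..}. indicator {ennreal s<..} (distr_fun f a) \<partial>lborel)"
proof -
  let ?A = "{a::real. 0 < a \<and> ennreal s < distr_fun f a}"
  have "(\<integral>\<^sup>+a\<in>{0<..}. indicator {ennreal s<..} (distr_fun f a) \<partial>lborel) =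
    (\<integral>\<^sup>+a. indicator ?A a \<partial>lborel)"
    by (intro nn_integral_cong) (auto simp: indicator_def)
  also have "\<dots> = emeasure lborel ?A"
    by (rule nn_integral_indicator) measurable
  also have "\<dots> = rearrangement f s"
  proof (rule antisym)
    show "emeasure lborel ?A \<le> rearrangement f s"
      unfolding rearrangement_def
    proof (rule INF_greatest)
      fix \<alpha> :: real
      assume \<alpha>: "\<alpha> \<in> {\<alpha>. 0 < \<alpha> \<and> distr_fun f \<alpha> \<le> ennreal s}"
      have "a < \<alpha>" if "a \<in> ?A" for a
        using that \<alpha> distr_fun_antimono[OF assms, of \<alpha> a] by force
      then have "emeasure lborel ?A \<le> emeasure lborel {0<..<\<alpha>}"
        by (intro emeasure_mono) auto
      also have "\<dots> = ennreal \<alpha>" using \<alpha> by simp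
      finally show "emeasure lborel ?A \<le> ennreal \<alpha>" .
    qed
    show "rearrangement f s \<le> emeasure lborel ?A"
    proof (rule dense_le)
      fix c assume c: "c < rearrangement f s"
      then obtain c' where c': "c = ennreal c'" "0 \<le> c'" by (cases c) auto
      \<comment> \<open>A level \<open>a \<le> c'\<close> outside \<open>?A\<close> would compete in
        the infimum and push the rearrangement down to \<open>c\<close>.\<close>
      have "{0<..c'} \<subseteq> ?A"
      proof
        fix a assume a: "a \<in> {0<..c'}"
        have "ennreal s < distr_fun f a"
        proof (rule ccontr)
          assume "\<not> ennreal s < distr_fun f a"
          then have "rearrangement f s \<le> ennreal a"
            unfolding rearrangement_def using a by (intro INF_lower) auto
          then have "rearrangement f s \<le> c"
            using a c' by (auto intro: order_trans ennreal_leI)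
          with c show False by simp
        qed
        with a show "a \<in> ?A" by simp
      qed
      then have "emeasure lborel {0<..c'} \<le> emeasure lborel ?A"
        by (intro emeasure_mono) auto
      then show "c \<le> emeasure lborel ?A" using c' by simp
    qed
  qed
  finally show ?thesis ..
qed

lemma borel_measurable_rearrangement [measurable]:
  assumes [measurable]: "f \<in> borel_measurable lebesgue"
  shows "rearrangement f \<in> borel_measurable borel"
proof -
  have "rearrangement f = (\<lambda>s. \<integral>\<^sup>+a. indicator {z. ennreal (fst z) < distr_fun f (snd z)} (s, a)
     * indicator {0<..} a \<partial>lborel)"
    by (rule ext, subst rearrangement_eq[OF assms], rule nn_integral_cong) (auto simp: indicator_def)
  also have "\<dots> \<in> borel_measurable borel"
    by measurable
  finally show ?thesis .
qed

text \<open>Applied to the minimum of two measures, this layer-cake formula produces the variable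
  \<open>s\<close> of the rearrangements in the Hardy-Littlewood inequality. The infinite value is
  included because distribution functions may be infinite.\<close>

lemma nn_integral_less_indicator: "(\<integral>\<^sup>+s\<in>{0<..}. indicator {ennreal s<..} x \<partial>lborel) = x"
proof (cases x)
  case (real r)
  have "(\<integral>\<^sup>+s\<in>{0<..}. indicator {ennreal s<..} x \<partial>lborel) = (\<integral>\<^sup>+s. indicator {0<..<r} s \<partial>lborel)"
    using real by (intro nn_integral_cong) (auto simp: indicator_def ennreal_less_iff)
  then show ?thesis using real by simp
next
  case top
  have "emeasure lborel {0::real<..} = \<infinity>"
  proof (rule ccontr)
    assume "emeasure lborel {0::real<..} \<noteq> \<infinity>"
    then obtain r where r: "emeasure lborel {0::real<..} = ennreal r" "0 \<le> r"
      by (cases "emeasure lborel {0::real<..}") auto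
    have "emeasure lborel {0<..<r + 1} \<le> emeasure lborel {0::real<..}"
      by (intro emeasure_mono) auto
    with r show False by simp
  qed
  moreover have "(\<integral>\<^sup>+s\<in>{0<..}. indicator {ennreal s<..} x \<partial>lborel) = (\<integral>\<^sup>+s. indicator {0::real<..} s \<partial>lborel)"
    using top by (intro nn_integral_cong) (auto simp: indicator_def)
  ultimately show ?thesis using top by simp
qed

text \<open>\<open>cnj (sgn z)\<close> is the phase that turns test integrals of a function into
  integrals of its modulus; \<open>sgn 0 = 0\<close> covers the zeros.\<close>

lemma cnj_sgn_mult: "cnj (sgn z) * z = complex_of_real (cmod z)"
  by (cases "z = 0") (simp_all add: sgn_eq complex_norm_square[symmetric] field_simps power2_eq_square
      flip: of_real_mult)

lemma wL_measurable: "g \<in> wL \<Psi> \<Longrightarrow> g \<in> borel_measurable lebesgue"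
  by (simp add: wL_def)

section \<open>The Hardy-Littlewood inequality by layers\<close>

lemma layer_cake_cmod:
  "ennreal (cmod z) = (\<integral>\<^sup>+a\<in>{0<..}. indicator {a<..} (cmod z) \<partial>lborel)"
proof -
  have "(\<integral>\<^sup>+a\<in>{0<..}. indicator {a<..} (cmod z) \<partial>lborel) = (\<integral>\<^sup>+a. indicator {0<..<cmod z} a \<partial>lborel)"
    by (intro nn_integral_cong) (auto simp: indicator_def)
  then show ?thesis by simp
qed

text \<open>Splitting both moduli into layers reduces the claim to the intersection of two
  superlevel sets, whose measure is at most the smaller of the two. That minimum is the length of
  the set of \<open>s > 0\<close> lying below both measures; integrating over the levels with
  \<open>s\<close> held fixed gives the product of the rearrangements.\<close>

lemma Hardy_Littlewood:
  fixes f g :: "real ^ 'n \<Rightarrow> complex"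
  assumes [measurable]: "f \<in> borel_measurable lebesgue" "g \<in> borel_measurable lebesgue"
  shows "(\<integral>\<^sup>+x. ennreal (cmod (f x * g x)) \<partial>lebesgue) \<le>
    (\<integral>\<^sup>+s\<in>{0<..}. rearrangement f s * rearrangement g s \<partial>lborel)"
proof -
  interpret leb: sigma_finite_measure "lebesgue :: (real ^ 'n) measure"
    by (rule sigma_finite_lebesgue)
  interpret pair_sigma_finite "lebesgue :: (real ^ 'n) measure" "lborel :: real measure"
    by standard
  define H :: "(real ^ 'n \<Rightarrow> complex) \<Rightarrow> real \<Rightarrow> real ^ 'n \<Rightarrow> ennreal"
    where "H u a x = indicator {z. 0 < fst z \<and> fst z < cmod (u (snd z))} (a, x)" for u a x
  have H [measurable]: "(\<lambda>(a, x). H u a x) \<in> borel_measurable (borel \<Otimes>\<^sub>M lebesgue)"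
    if [measurable]: "u \<in> borel_measurable lebesgue" for u
  proof -
    have "(\<lambda>(a, x). H u a x) =
       indicator {z \<in> space (borel \<Otimes>\<^sub>M lebesgue). 0 < fst z \<and> fst z < cmod (u (snd z))}"
      by (auto simp: H_def indicator_def space_pair_measure)
    also have "\<dots> \<in> borel_measurable (borel \<Otimes>\<^sub>M lebesgue)"
      by measurable
    finally show ?thesis .
  qed
  have cm: "ennreal (cmod (u x)) = (\<integral>\<^sup>+a. H u a x \<partial>lborel)" for u x
    unfolding layer_cake_cmod by (intro nn_integral_cong) (auto simp: H_def indicator_def)
  \<comment> \<open>Extending \<open>distr_fun\<close> by 0 to levels \<open>a \<le> 0\<close> lets
    the level integrals run over the whole line.\<close>
  define m where "m u a = distr_fun u a * indicator {0<..} a" for u :: "real ^ 'n \<Rightarrow> complex" and a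
  have m [measurable]: "m u \<in> borel_measurable borel" if [measurable]: "u \<in> borel_measurable lebesgue" for u
    unfolding m_def by measurable
  define K where "K u s a = (indicator {z. ennreal (fst z) < m u (snd z)} (s, a) :: ennreal)"
    for u :: "real ^ 'n \<Rightarrow> complex" and s a :: real
  have K [measurable]: "(\<lambda>(s, a). K u s a) \<in> borel_measurable (borel \<Otimes>\<^sub>M borel)"
    if [measurable]: "u \<in> borel_measurable lebesgue" for u
    unfolding K_def by measurable
  have rK: "rearrangement u s = (\<integral>\<^sup>+a. K u s a \<partial>lborel)"
    if [measurable]: "u \<in> borel_measurable lebesgue" for u s
    by (subst rearrangement_eq[OF that], rule nn_integral_cong) (auto simp: K_def m_def indicator_def)
  have Hm: "(\<integral>\<^sup>+x. H u a x \<partial>lebesgue) = m u a"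
    if [measurable]: "u \<in> borel_measurable lebesgue" for u a
  proof (cases "0 < a")
    case True
    then have "(\<integral>\<^sup>+x. H u a x \<partial>lebesgue) = (\<integral>\<^sup>+x. indicator {x. a < cmod (u x)} x \<partial>lebesgue)"
      by (intro nn_integral_cong) (auto simp: H_def indicator_def)
    also have "\<dots> = distr_fun u a"
      unfolding distr_fun_def by (rule nn_integral_indicator) measurable
    finally show ?thesis using True by (simp add: m_def)
  qed (simp add: H_def m_def)
  have key: "(\<integral>\<^sup>+x. H f a x * H g b x \<partial>lebesgue) \<le> (\<integral>\<^sup>+s\<in>{0<..}. K f s a * K g s b \<partial>lborel)" for a b
  proof -
    have "(\<integral>\<^sup>+x. H f a x * H g b x \<partial>lebesgue) \<le> (\<integral>\<^sup>+x. H f a x \<partial>lebesgue)"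
      by (intro nn_integral_mono) (auto simp: H_def indicator_def)
    also have "\<dots> = m f a"
      by (rule Hm) measurable
    finally have 1: "(\<integral>\<^sup>+x. H f a x * H g b x \<partial>lebesgue) \<le> m f a" .
    have "(\<integral>\<^sup>+x. H f a x * H g b x \<partial>lebesgue) \<le> (\<integral>\<^sup>+x. H g b x \<partial>lebesgue)"
      by (intro nn_integral_mono) (auto simp: H_def indicator_def)
    also have "\<dots> = m g b"
      by (rule Hm) measurable
    finally have 2: "(\<integral>\<^sup>+x. H f a x * H g b x \<partial>lebesgue) \<le> min (m f a) (m g b)"
      using 1 by simp
    also have "\<dots> = (\<integral>\<^sup>+s\<in>{0<..}. indicator {ennreal s<..} (min (m f a) (m g b)) \<partial>lborel)"
      by (rule nn_integral_less_indicator[symmetric])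
    also have "\<dots> = (\<integral>\<^sup>+s\<in>{0<..}. K f s a * K g s b \<partial>lborel)"
      by (intro nn_integral_cong) (auto simp: K_def indicator_def)
    finally show ?thesis .
  qed
  have "(\<integral>\<^sup>+x. ennreal (cmod (f x * g x)) \<partial>lebesgue) =
     (\<integral>\<^sup>+x. (\<integral>\<^sup>+a. (\<integral>\<^sup>+b. H f a x * H g b x \<partial>lborel) \<partial>lborel) \<partial>lebesgue)"
    by (simp add: norm_mult ennreal_mult cm nn_integral_multc nn_integral_cmult)
  also have "\<dots> = (\<integral>\<^sup>+a. (\<integral>\<^sup>+x. (\<integral>\<^sup>+b. H f a x * H g b x \<partial>lborel) \<partial>lebesgue) \<partial>lborel)"
    by (rule Fubini'[symmetric]) measurable
  also have "\<dots> = (\<integral>\<^sup>+a. (\<integral>\<^sup>+b. (\<integral>\<^sup>+x. H f a x * H g b x \<partial>lebesgue) \<partial>lborel) \<partial>lborel)"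
    by (intro nn_integral_cong Fubini'[symmetric]) measurable
  also have "\<dots> \<le> (\<integral>\<^sup>+a. (\<integral>\<^sup>+b. (\<integral>\<^sup>+s\<in>{0<..}. K f s a * K g s b \<partial>lborel) \<partial>lborel) \<partial>lborel)"
    by (intro nn_integral_mono key)
  also have "\<dots> = (\<integral>\<^sup>+a. (\<integral>\<^sup>+s. (\<integral>\<^sup>+b. K f s a * K g s b * indicator {0<..} s \<partial>lborel) \<partial>lborel) \<partial>lborel)"
    by (intro nn_integral_cong lborel_pair.Fubini') measurable
  also have "\<dots> = (\<integral>\<^sup>+s. (\<integral>\<^sup>+a. (\<integral>\<^sup>+b. K f s a * K g s b * indicator {0<..} s \<partial>lborel) \<partial>lborel) \<partial>lborel)"
    by (intro lborel_pair.Fubini') measurable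
  also have "\<dots> = (\<integral>\<^sup>+s\<in>{0<..}. rearrangement f s * rearrangement g s \<partial>lborel)"
    by (simp add: rK nn_integral_multc nn_integral_cmult)
  finally show ?thesis .
qed

section \<open>Densities of signed measures\<close>

lemma integrable_complex_of_realD:
  "integrable M (\<lambda>x. complex_of_real (f x)) \<Longrightarrow> integrable M f"
  using integrable_bounded_linear[OF bounded_linear_Re, of M "\<lambda>x. complex_of_real (f x)"] by simp

text \<open>A Jordan decomposition without a Hahn set: the positive variations of
  \<open>\<nu>\<close> and of its negative are measures, finite because of \<open>K\<close> and zero
  on null sets, so both have integrable densities, and their difference is
  \<open>\<nu>\<close>.\<close>

lemma signed_Radon_Nikodym:
  fixes \<nu> :: "'a set \<Rightarrow> real"
  assumes "sigma_finite_measure M"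
    and sums: "\<And>A. range A \<subseteq> sets M \<Longrightarrow> disjoint_family A \<Longrightarrow> (\<lambda>i. \<nu> (A i)) sums \<nu> (\<Union>i. A i)"
    and bounded: "\<And>A. A \<in> sets M \<Longrightarrow> \<bar>\<nu> A\<bar> \<le> K"
    and ac: "\<And>A. A \<in> null_sets M \<Longrightarrow> \<nu> A = 0"
  obtains h :: "'a \<Rightarrow> real" where "integrable M h"
    and "\<And>A. A \<in> sets M \<Longrightarrow> \<nu> A = (\<integral>x. indicator A x * h x \<partial>M)"
proof -
  interpret sigma_finite_measure M by fact
  have empty: "\<nu> {} = 0"
    by (rule ac) simp
  have Un: "\<nu> (A \<union> B) = \<nu> A + \<nu> B" if "A \<in> sets M" "B \<in> sets M" "A \<inter> B = {}" for A B
  proof -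
    have "(\<lambda>i. \<nu> (binaryset A B i)) sums \<nu> (\<Union>i. binaryset A B i)"
      using that by (intro sums)
        (auto simp: range_binaryset_eq disjoint_family_on_def binaryset_def)
    moreover have "(\<lambda>i. \<nu> (binaryset A B i)) sums (\<nu> A + \<nu> B)"
      by (rule binaryset_sums) (rule empty)
    ultimately show ?thesis
      by (simp add: UN_binaryset_eq sums_unique2)
  qed
  text \<open>The positive variation, taken of \<open>c * \<nu>\<close> with \<open>c = 1\<close> or \<open>c = -1\<close>.\<close>
  define P where "P c A = (SUP F \<in> {F \<in> sets M. F \<subseteq> A}. ennreal (c * \<nu> F))" for c :: real and A
  have upper: "ennreal (c * \<nu> F) \<le> P c A" if "F \<in> sets M" "F \<subseteq> A" for c F A
    unfolding P_def using that by (intro SUP_upper) auto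
  have P_finite: "P c A \<le> ennreal (\<bar>c\<bar> * K)" for c A
    unfolding P_def
  proof (rule SUP_least)
    fix F assume "F \<in> {F \<in> sets M. F \<subseteq> A}"
    then have "\<bar>c * \<nu> F\<bar> \<le> \<bar>c\<bar> * K"
      using bounded by (simp add: abs_mult mult_left_mono)
    then show "ennreal (c * \<nu> F) \<le> ennreal (\<bar>c\<bar> * K)"
      by (intro ennreal_leI) auto
  qed
  have P_null: "P c A = 0" if "A \<in> null_sets M" for c A
  proof -
    have "c * \<nu> F = 0" if "F \<in> sets M" "F \<subseteq> A" for F
      using ac null_sets_subset[OF _ that(1) that(2)] \<open>A \<in> null_sets M\<close> by simp
    then have "P c A \<le> 0"
      unfolding P_def by (intro SUP_least) (metis (mono_tags, lifting) ennreal_0 mem_Collect_eq order_refl)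
    then show ?thesis by simp
  qed
  have P_mono: "P c A \<le> P c B" if "A \<subseteq> B" for c A B
    unfolding P_def using that by (intro SUP_subset_mono) auto
  have P_Un: "P c A + P c B \<le> P c (A \<union> B)" if [measurable]: "A \<in> sets M" "B \<in> sets M" "A \<inter> B = {}" for c A B
  proof -
    have nonempty: "{F \<in> sets M. F \<subseteq> A} \<noteq> {}" for A by auto
    have "ennreal (c * \<nu> F) + ennreal (c * \<nu> G) \<le> P c (A \<union> B)"
      if "F \<in> sets M" "F \<subseteq> A" "G \<in> sets M" "G \<subseteq> B" for F G
    proof -
      have dj: "F \<inter> G = {}" using that \<open>A \<inter> B = {}\<close> by auto
      show ?thesis
      \<comment> \<open>A negative value becomes 0 under \<open>ennreal\<close>, and then the other
        term alone bounds the sum.\<close>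
      proof (cases "0 \<le> c * \<nu> F \<and> 0 \<le> c * \<nu> G")
        case True
        have "ennreal (c * \<nu> F) + ennreal (c * \<nu> G) = ennreal (c * \<nu> (F \<union> G))"
          using True Un[OF that(1,3) dj] by (simp add: distrib_left flip: ennreal_plus)
        also have "\<dots> \<le> P c (A \<union> B)"
          using that by (intro upper) auto
        finally show ?thesis .
      next
        case False
        moreover have "ennreal (c * \<nu> F) \<le> P c (A \<union> B)" "ennreal (c * \<nu> G) \<le> P c (A \<union> B)"
          using that by (auto intro!: upper)
        ultimately show ?thesis
          by (auto simp: not_le ennreal_neg)
      qed
    qed
    then show ?thesis
      unfolding P_def[of c A] P_def[of c B]
        ennreal_SUP_add_left[OF nonempty, symmetric] ennreal_SUP_add_right[OF nonempty]
      by (intro SUP_least) auto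
  qed
  have P_ca: "countably_additive (sets M) (P c)" for c
  proof (rule countably_additiveI)
    fix A :: "nat \<Rightarrow> 'a set"
    assume A: "range A \<subseteq> sets M" "disjoint_family A" "(\<Union>i. A i) \<in> sets M"
    have Am: "A i \<in> sets M" for i using A by auto
    show "(\<Sum>i. P c (A i)) = P c (\<Union>i. A i)"
    proof (rule antisym)
      have fin: "(\<Sum>i<n. P c (A i)) \<le> P c (\<Union>i<n. A i)" for n
      proof (induction n)
        case (Suc n)
        have "(\<Sum>i<Suc n. P c (A i)) \<le> P c (\<Union>i<n. A i) + P c (A n)"
          using Suc by (simp add: add_right_mono)
        also have "\<dots> \<le> P c ((\<Union>i<n. A i) \<union> A n)"
        proof (rule P_Un)
          show "(\<Union>i<n. A i) \<inter> A n = {}"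
            using disjoint_family_onD[OF A(2), of _ n] by (auto simp: less_le) (metis IntI empty_iff)
        qed (use Am in auto)
        also have "(\<Union>i<n. A i) \<union> A n = (\<Union>i<Suc n. A i)"
          by (auto simp: less_Suc_eq)
        finally show ?case .
      qed (simp add: P_def)
      show "(\<Sum>i. P c (A i)) \<le> P c (\<Union>i. A i)"
        unfolding suminf_eq_SUP
        by (intro SUP_least order_trans[OF fin] P_mono) auto
      \<comment> \<open>Each competitor \<open>F\<close> is cut along the \<open>A i\<close>; its
        value is the limit of partial sums whose terms are bounded by
        \<open>P c (A i)\<close>.\<close>
      show "P c (\<Union>i. A i) \<le> (\<Sum>i. P c (A i))"
        unfolding P_def[of c "\<Union>i. A i"]
      proof (rule SUP_least)
        fix F assume F: "F \<in> {F \<in> sets M. F \<subseteq> (\<Union>i. A i)}"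
        have "(\<lambda>i. \<nu> (F \<inter> A i)) sums \<nu> (\<Union>i. F \<inter> A i)"
          using F Am A(2) by (intro sums) (auto simp: disjoint_family_on_def)
        moreover have "(\<Union>i. F \<inter> A i) = F" using F by auto
        ultimately have s: "(\<lambda>i. c * \<nu> (F \<inter> A i)) sums (c * \<nu> F)"
          using sums_mult by metis
        have "(\<Sum>i<n. c * \<nu> (F \<inter> A i)) \<le> enn2real (\<Sum>i. P c (A i))"
          if fin: "(\<Sum>i. P c (A i)) < \<infinity>" for n
        proof -
          \<comment> \<open>The summands may have mixed signs, on which \<open>ennreal\<close> is
            not additive; their positive parts are handled instead.\<close>
          have "ennreal (\<Sum>i<n. c * \<nu> (F \<inter> A i)) \<le> ennreal (\<Sum>i<n. max 0 (c * \<nu> (F \<inter> A i)))"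
            by (intro ennreal_leI sum_mono) auto
          also have "\<dots> = (\<Sum>i<n. ennreal (c * \<nu> (F \<inter> A i)))"
            by (subst sum_ennreal[symmetric])
              (simp, intro sum.cong, auto simp: max_def ennreal_neg simp del: sum_ennreal)
          also have "\<dots> \<le> (\<Sum>i<n. P c (A i))"
            using F Am by (intro sum_mono upper) auto
          also have "\<dots> \<le> (\<Sum>i. P c (A i))"
            by (intro sum_le_suminf) auto
          finally have "ennreal (\<Sum>i<n. c * \<nu> (F \<inter> A i)) \<le> ennreal (enn2real (\<Sum>i. P c (A i)))"
            using fin by (simp add: less_top)
          then show ?thesis
            by (simp add: ennreal_le_iff)
        qed
        then have le: "c * \<nu> F \<le> enn2real (\<Sum>i. P c (A i))" if "(\<Sum>i. P c (A i)) < \<infinity>"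
          using s that unfolding sums_def by (intro LIMSEQ_le_const2) auto
        show "ennreal (c * \<nu> F) \<le> (\<Sum>i. P c (A i))"
        proof (cases "(\<Sum>i. P c (A i)) < \<infinity>")
          case True
          then have "ennreal (c * \<nu> F) \<le> ennreal (enn2real (\<Sum>i. P c (A i)))"
            using le by (intro ennreal_leI)
          also have "\<dots> = (\<Sum>i. P c (A i))" using True by simp
          finally show ?thesis .
        qed (auto simp: not_less top_unique)
      qed
    qed
  qed
  define N where "N c = measure_of (space M) (sets M) (P c)" for c
  have sets_N: "sets (N c) = sets M" for c
    unfolding N_def by simp
  have em_N: "emeasure (N c) A = P c A" if "A \<in> sets M" for c A
    unfolding N_def
  proof (rule emeasure_measure_of_sigma)
    show "positive (sets M) (P c)"
      unfolding positive_def using P_null[of "{}"] by simp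
  qed (use that P_ca in \<open>auto simp: sets.sigma_algebra_axioms\<close>)
  have "\<exists>h. h \<in> borel_measurable M \<and> (\<forall>x. 0 \<le> h x) \<and> integrable M h \<and>
      (\<forall>A\<in>sets M. P c A = ennreal (\<integral>x. indicator A x * h x \<partial>M))" for c
  proof -
    have "absolutely_continuous M (N c)"
      unfolding absolutely_continuous_def using em_N P_null
      by (auto simp: null_sets_def sets_N)
    then obtain u where u [measurable]: "u \<in> borel_measurable M" and d: "density M u = N c"
      using Radon_Nikodym sets_N by blast
    have Pu: "P c A = (\<integral>\<^sup>+x. u x * indicator A x \<partial>M)" if "A \<in> sets M" for A
      using em_N[OF that, of c] emeasure_density[OF u that] d by simp
    have "(\<integral>\<^sup>+x. u x \<partial>M) = P c (space M)"
      using Pu[of "space M"] by (simp cong: nn_integral_cong)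
    then have fin: "(\<integral>\<^sup>+x. u x \<partial>M) \<noteq> \<infinity>"
      using P_finite[of c "space M"] by (auto simp: top_unique)
    have AEu: "AE x in M. u x \<noteq> \<infinity>"
      using fin by (intro nn_integral_PInf_AE) auto
    define h where "h x = enn2real (u x)" for x
    have [measurable]: "h \<in> borel_measurable M"
      unfolding h_def by measurable
    have AEh: "AE x in M. ennreal (h x) = u x"
      using AEu by eventually_elim (auto simp: h_def less_top)
    have int: "integrable M h"
    proof (rule integrableI_nonneg)
      have "(\<integral>\<^sup>+x. ennreal (h x) \<partial>M) = (\<integral>\<^sup>+x. u x \<partial>M)"
        using AEh by (intro nn_integral_cong_AE) auto
      then show "(\<integral>\<^sup>+x. ennreal (h x) \<partial>M) < \<infinity>" using fin by (simp add: less_top)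
    qed (auto simp: h_def)
    have "P c A = ennreal (\<integral>x. indicator A x * h x \<partial>M)" if [measurable]: "A \<in> sets M" for A
    proof -
      have "P c A = (\<integral>\<^sup>+x. ennreal (indicator A x * h x) \<partial>M)"
        unfolding Pu[OF that] using AEh
        by (intro nn_integral_cong_AE) (auto simp: indicator_def)
      also have "\<dots> = ennreal (\<integral>x. indicator A x * h x \<partial>M)"
        using integrable_mult_indicator[OF that int]
        by (intro nn_integral_eq_integral) (auto simp: h_def)
      finally show ?thesis .
    qed
    then show ?thesis using int by (intro exI[of _ h]) (auto simp: h_def)
  qed
  then obtain H where H: "\<And>c. integrable M (H c)" "\<And>c x. 0 \<le> H c x"
    "\<And>c A. A \<in> sets M \<Longrightarrow> P c A = ennreal (\<integral>x. indicator A x * H c x \<partial>M)"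
    by metis
  let ?h = "\<lambda>x. H 1 x - H (-1) x"
  have "\<nu> A = (\<integral>x. indicator A x * ?h x \<partial>M)" if A [measurable]: "A \<in> sets M" for A
  proof -
    define p where "p c = (\<integral>x. indicator A x * H c x \<partial>M)" for c :: real
    have p_nonneg: "0 \<le> p c" for c
      unfolding p_def using H by (intro Bochner_Integration.integral_nonneg) auto
    have pP: "P c A = ennreal (p c)" for c using H(3)[OF A] by (simp add: p_def)
    \<comment> \<open>For \<open>F \<subseteq> A\<close>, \<open>- c * \<nu> F\<close> equals
      \<open>c * \<nu> (A - F) - c * \<nu> A\<close> and is at most
      \<open>p c - c * \<nu> A\<close>; the supremum over \<open>F\<close> gives the claim. The
      cases \<open>c = 1\<close> and \<open>c = -1\<close> are the two halves of
      \<open>\<nu> A = p 1 - p (- 1)\<close>.\<close>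
    have compl: "c * \<nu> A + p (- c) \<le> p c" for c
    proof -
      have "ennreal (- c * \<nu> F) \<le> ennreal (p c - c * \<nu> A)" if "F \<in> sets M" "F \<subseteq> A" for F
      proof -
        have "\<nu> A = \<nu> F + \<nu> (A - F)"
          using Un[of F "A - F"] that A by (simp add: Un_absorb1)
        moreover have "ennreal (c * \<nu> (A - F)) \<le> ennreal (p c)"
          unfolding pP[symmetric] using that by (intro upper) auto
        then have "c * \<nu> (A - F) \<le> p c"
          using p_nonneg by (simp add: ennreal_le_iff)
        ultimately show ?thesis by (intro ennreal_leI) (simp add: algebra_simps)
      qed
      then have "P (- c) A \<le> ennreal (p c - c * \<nu> A)"
        unfolding P_def by (intro SUP_least) auto
      moreover have "0 \<le> p c - c * \<nu> A"
        using upper[of A A c] A p_nonneg[of c] by (simp add: pP ennreal_le_iff)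
      ultimately show ?thesis
        by (simp add: pP ennreal_le_iff)
    qed
    have "\<nu> A = p 1 - p (- 1)"
      using compl[of 1] compl[of "-1"] by simp
    also have "\<dots> = (\<integral>x. indicator A x * ?h x \<partial>M)"
      unfolding p_def using integrable_mult_indicator[OF A H(1)]
      by (subst Bochner_Integration.integral_diff[symmetric])
        (auto simp: right_diff_distrib)
    finally show ?thesis .
  qed
  then show thesis
    using H(1) by (intro that[of ?h]) auto
qed

section \<open>Young functions with the doubling condition\<close>

lemma term_le_suminf:
  fixes f :: "nat \<Rightarrow> ennreal"
  shows "f n \<le> suminf f"
  using sum_le_suminf[of f "{n}"] by simp

text \<open>The constant \<open>k\<close> is a parameter because it is also the ratio of the
  geometric scale in the estimate of \<open>W\<close> and the constant of the lower dual
  bound.\<close>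

locale delta2_young =
  fixes \<Phi> :: "ennreal \<Rightarrow> ennreal" and k :: real
  assumes young: "young_function \<Phi>" and k_gt_1: "1 < k"
    and doubling: "\<And>r. 0 < r \<Longrightarrow> \<Phi> (2 * r) \<le> ennreal k * \<Phi> r"
begin

lemma mono_Phi: "x \<le> y \<Longrightarrow> \<Phi> x \<le> \<Phi> y"
  using young unfolding young_function_def mono_def by blast

lemma Phi_0: "\<Phi> 0 = 0"
  using young unfolding young_function_def by blast

text \<open>A finite \<open>young_b\<close> would be crossed by one doubling from a point where
  \<open>\<Phi>\<close> is still finite.\<close>

lemma young_b_infinite: "young_b \<Phi> = \<infinity>"
proof (rule ccontr)
  assume "young_b \<Phi> \<noteq> \<infinity>"
  moreover have "0 < young_b \<Phi>"
    using young unfolding young_function_def by blast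
  ultimately obtain \<beta> where \<beta>: "young_b \<Phi> = ennreal \<beta>" "0 < \<beta>"
    by (cases "young_b \<Phi>") auto
  \<comment> \<open>Any fraction strictly between 1/2 and 1 serves: \<open>r\<close> lies below
    \<open>\<beta>\<close> and \<open>2 * r\<close> above it.\<close>
  define r where "r = ennreal (3 / 4 * \<beta>)"
  have "r < young_b \<Phi>" using \<beta> by (simp add: r_def ennreal_less_iff)
  then have "\<Phi> r \<noteq> \<infinity>"
    unfolding young_b_def by (metis (mono_tags) Inf_lower leD mem_Collect_eq)
  then have "ennreal k * \<Phi> r < \<infinity>"
    by (simp add: ennreal_mult_less_top less_top)
  then have fin: "\<Phi> (2 * r) < \<infinity>"
    using doubling[of r] \<beta> by (auto simp: r_def)
  have "2 * r = ennreal (3 / 2 * \<beta>)"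
    using \<beta> by (simp add: r_def flip: ennreal_numeral ennreal_mult)
  then have "young_b \<Phi> < 2 * r"
    using \<beta> by (simp add: ennreal_less_iff)
  then obtain t where "\<Phi> t = \<infinity>" "t < 2 * r"
    unfolding young_b_def Inf_less_iff by auto
  then show False
    using fin mono_Phi[of t "2 * r"] by (auto simp: top_unique)
qed

lemma Phi_finite: "\<Phi> (ennreal t) < \<infinity>"
  using young_b_infinite unfolding young_b_def
  by (metis (mono_tags, lifting) Inf_lower ennreal_neq_top infinity_ennreal_def mem_Collect_eq
      top.not_eq_extremum top_unique)

text \<open>A zero at \<open>t > 0\<close> would spread by doubling to every
  \<open>2 ^ n * t\<close> and make \<open>young_a\<close> infinite.\<close>

lemma Phi_pos:
  assumes "0 < t"
  shows "0 < \<Phi> t"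
proof (rule ccontr)
  assume "\<not> 0 < \<Phi> t"
  then have 0: "\<Phi> (2 ^ n * t) = 0" for n
  proof (induction n)
    case (Suc n)
    have "(1 :: ennreal) \<le> 2 ^ n"
      by (rule one_le_power) simp
    then have "(0 :: ennreal) < 2 ^ n"
      by (rule less_le_trans[OF zero_less_one])
    then have "\<Phi> (2 * (2 ^ n * t)) \<le> ennreal k * \<Phi> (2 ^ n * t)"
      using assms by (intro doubling) (auto simp: ennreal_zero_less_mult_iff)
    then show ?case using Suc by (simp add: mult.assoc)
  qed simp
  have "t < \<infinity>"
  proof (rule ccontr)
    assume "\<not> t < \<infinity>"
    then have "\<Phi> \<infinity> = 0" using 0[of 0] by (auto simp: not_less top_unique)
    then show False
      using young young_b_infinite unfolding young_function_def by simp
  qed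
  then obtain \<tau> where \<tau>: "t = ennreal \<tau>" "0 < \<tau>"
    using assms by (cases t) auto
  have "young_a \<Phi> = \<infinity>"
  proof (rule ccontr)
    assume "young_a \<Phi> \<noteq> \<infinity>"
    then obtain \<alpha> where \<alpha>: "young_a \<Phi> = ennreal \<alpha>" "0 \<le> \<alpha>" by (cases "young_a \<Phi>") auto
    obtain n where n: "\<alpha> / \<tau> < 2 ^ n"
      using real_arch_pow[of 2 "\<alpha> / \<tau>"] by auto
    have "2 ^ n * t = ennreal (2 ^ n * \<tau>)"
      using \<tau> by (simp add: ennreal_mult flip: ennreal_power ennreal_numeral)
    moreover have "2 ^ n * t \<le> young_a \<Phi>"
      unfolding young_a_def using 0[of n] by (intro Sup_upper) auto
    ultimately show False
      using \<alpha> n \<tau> by (simp add: ennreal_le_iff field_simps)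
  qed
  then show False
    using young unfolding young_function_def by simp
qed

text \<open>A real-valued copy of \<open>\<Phi>\<close>, so that \<open>convex_on\<close> and the
  intermediate value theorem apply.\<close>

definition P :: "real \<Rightarrow> real" where "P r = enn2real (\<Phi> (ennreal r))"

lemma Phi_eq_P: "\<Phi> (ennreal r) = ennreal (P r)"
  using Phi_finite[of r] by (simp add: P_def)

lemma P_nonneg: "0 \<le> P r"
  by (simp add: P_def)

lemma P_pos: "0 < r \<Longrightarrow> 0 < P r"
  using Phi_pos[of "ennreal r"] by (simp add: Phi_eq_P)

lemma P_0: "P 0 = 0"
  by (simp add: P_def Phi_0)

lemma convex_P: "convex_on {0..} P"
proof (rule convex_onI)
  fix u x y :: real
  assume u: "0 < u" "u < 1" and xy: "x \<in> {0..}" "y \<in> {0..}"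
  have conv: "\<forall>x < young_b \<Phi>. \<forall>y < young_b \<Phi>. \<forall>u \<in> {0..1::real}.
        \<Phi> (ennreal u * x + ennreal (1 - u) * y) \<le> ennreal u * \<Phi> x + ennreal (1 - u) * \<Phi> y"
    using young unfolding young_function_def by blast
  have "\<Phi> (ennreal (1 - u) * ennreal x + ennreal (1 - (1 - u)) * ennreal y) \<le>
      ennreal (1 - u) * \<Phi> (ennreal x) + ennreal (1 - (1 - u)) * \<Phi> (ennreal y)"
    using u by (intro conv[rule_format]) (auto simp: young_b_infinite)
  then have "ennreal (P ((1 - u) * x + u * y)) \<le> ennreal ((1 - u) * P x + u * P y)"
    using u xy P_nonneg by (simp add: Phi_eq_P flip: ennreal_mult ennreal_plus)
  then show "P ((1 - u) *\<^sub>R x + u *\<^sub>R y) \<le> (1 - u) * P x + u * P y"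
    using u P_nonneg by (subst (asm) ennreal_le_iff) auto
qed (rule convex_real_interval)

text \<open>Convexity between 0 and \<open>x\<close> with \<open>P 0 = 0\<close>. Increasing slopes,
  strict monotonicity and the bracketing of values in \<open>P_surj\<close> all rest on
  this.\<close>

lemma P_scale: "0 \<le> u \<Longrightarrow> u \<le> 1 \<Longrightarrow> 0 \<le> x \<Longrightarrow> P (u * x) \<le> u * P x"
  using convex_onD[OF convex_P, of u 0 x] by (simp add: P_0)

lemma P_slope_mono:
  assumes "0 < x" "x \<le> y"
  shows "P x / x \<le> P y / y"
  using P_scale[of "x / y" y] assms by (simp add: field_simps)

lemma P_strict_mono:
  assumes "0 \<le> x" "x < y"
  shows "P x < P y"
proof -
  have "P x \<le> x / y * P y" using P_scale[of "x / y" y] assms by simp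
  also have "\<dots> < 1 * P y" using assms P_pos[of y] by (intro mult_strict_right_mono) auto
  finally show ?thesis by simp
qed

lemma P_le_iff: "0 \<le> x \<Longrightarrow> 0 \<le> y \<Longrightarrow> P x \<le> P y \<longleftrightarrow> x \<le> y"
  by (metis P_strict_mono linorder_not_less order.order_iff_strict)

lemma P_surj:
  assumes "0 < u"
  obtains x where "0 < x" "P x = u"
proof -
  \<comment> \<open>Scaling from the point 1 brackets \<open>u\<close>:
    \<open>P a \<le> a * P 1 \<le> u \<le> b * P 1 \<le> P b\<close>. Moreover \<open>a > 0\<close>
    keeps the interval inside the open half line, where convexity gives continuity.\<close>
  define a b where "a = min 1 (u / P 1)" and "b = max 1 (u / P 1)"
  have P1: "0 < P 1" by (rule P_pos) simp
  have a: "0 < a" "a \<le> 1" "a * P 1 \<le> u" using assms P1 by (auto simp: a_def min_def field_simps)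
  have b: "1 \<le> b" "u \<le> b * P 1" using assms P1 by (auto simp: b_def max_def field_simps)
  have "P a \<le> u" using P_scale[of a 1] a by simp
  moreover have "u \<le> P b"
    using P_scale[of "1 / b" b] b by (simp add: field_simps)
  moreover have "continuous_on {a..b} P"
  proof (rule continuous_on_subset)
    show "continuous_on {0<..} P"
      by (intro convex_on_continuous convex_on_subset[OF convex_P]) auto
  qed (use a in auto)
  ultimately obtain x where "a \<le> x" "x \<le> b" "P x = u"
    using IVT'[of P a u b] a b by auto
  then show thesis using that[of x] a by auto
qed

text \<open>Strict monotonicity identifies the set in the infimum with the open ray above
  \<open>x\<close>, so the generalized inverse is a true one.\<close>

lemma gen_inverse_P:
  assumes "0 < x"
  shows "gen_inverse \<Phi> (ennreal (P x)) = ennreal x"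
proof -
  have "ennreal (P x) < \<Phi> t \<longleftrightarrow> ennreal x < t" for t
  proof (cases t)
    case (real r)
    then show ?thesis using assms P_le_iff[of r x] P_nonneg
      by (auto simp: Phi_eq_P ennreal_less_iff not_le[symmetric] simp del: not_le linorder_not_le)
  next
    case top
    then show ?thesis
      using young young_b_infinite unfolding young_function_def by simp
  qed
  then have "gen_inverse \<Phi> (ennreal (P x)) = Inf {ennreal x<..}"
    unfolding gen_inverse_def greaterThan_def by simp
  also have "\<dots> = ennreal x"
    by (rule antisym)
      (auto intro!: Inf_greatest dense_le_bounded dense_ge simp: Inf_lower)
  finally show ?thesis .
qed

section \<open>The weight \<open>w\<close> and its primitive \<open>W\<close>\<close>

definition q :: "real \<Rightarrow> real" where "q t = enn2real (gen_inverse \<Phi> (ennreal (1 / t)))"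

lemma
  assumes "0 < t"
  shows q_pos: "0 < q t" and P_q: "P (q t) = 1 / t"
    and gen_inverse_q: "gen_inverse \<Phi> (ennreal (1 / t)) = ennreal (q t)"
proof -
  obtain x where "0 < x" "P x = 1 / t"
    using P_surj[of "1 / t"] assms by auto
  moreover from this have "gen_inverse \<Phi> (ennreal (1 / t)) = ennreal x"
    using gen_inverse_P[of x] by simp
  ultimately show "0 < q t" "P (q t) = 1 / t" "gen_inverse \<Phi> (ennreal (1 / t)) = ennreal (q t)"
    by (auto simp: q_def)
qed

lemma q_less_iff: "0 < t \<Longrightarrow> 0 < x \<Longrightarrow> x < q t \<longleftrightarrow> P x < 1 / t"
  using P_le_iff[of "q t" x] q_pos[of t] P_q[of t] by (metis less_imp_le linorder_not_less)

lemma q_antimono: "0 < s \<Longrightarrow> s \<le> t \<Longrightarrow> q t \<le> q s"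
  using P_le_iff[of "q t" "q s"] by (simp add: P_q q_pos less_imp_le frac_le)

text \<open>For \<open>t > 0\<close> this is the Luxemburg norm, in the Orlicz space of
  \<open>\<Phi>\<close>, of the indicator of a set of measure \<open>t\<close>. The value 0
  elsewhere makes \<open>\<phi>\<close> monotone on the whole line, hence Borel, and confines
  \<open>w\<close> to the positive axis.\<close>

definition \<phi> :: "real \<Rightarrow> real" where "\<phi> t = (if 0 < t then 1 / q t else 0)"

definition w :: "real \<Rightarrow> real" where "w t = \<phi> t / t"

lemma mono_phi: "mono \<phi>"
proof (rule monoI)
  fix s t :: real assume "s \<le> t"
  then show "\<phi> s \<le> \<phi> t"
    using q_antimono[of s t] q_pos[of t] by (auto simp: \<phi>_def frac_le)
qed

lemma phi_pos: "0 < t \<Longrightarrow> 0 < \<phi> t"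
  using q_pos[of t] by (simp add: \<phi>_def)

lemma borel_measurable_w [measurable]: "w \<in> borel_measurable borel"
proof -
  have [measurable]: "\<phi> \<in> borel_measurable borel"
    using mono_phi by (rule borel_measurable_mono)
  show ?thesis unfolding w_def by measurable
qed

lemma w_nonneg: "0 \<le> w t"
  using phi_pos[of t] by (cases "0 < t") (auto simp: w_def \<phi>_def)

lemma w_pos: "0 < t \<Longrightarrow> 0 < w t"
  using q_pos[of t] by (simp add: w_def \<phi>_def)

lemma w_nonpos [simp]: "t \<le> 0 \<Longrightarrow> w t = 0"
  by (simp add: w_def \<phi>_def)

text \<open>The weight is the chord slope of \<open>P\<close> at \<open>q t\<close>. Increasing
  slopes of \<open>P\<close> and decreasing \<open>q\<close> thus make \<open>w\<close> decreasing,
  and the same form ties \<open>w\<close> to the complementary function.\<close>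

lemma w_eq: "0 < t \<Longrightarrow> w t = P (q t) / q t"
  by (simp add: w_def \<phi>_def P_q)

lemma w_antimono: "0 < s \<Longrightarrow> s \<le> t \<Longrightarrow> w t \<le> w s"
  using P_slope_mono[of "q t" "q s"] q_antimono[of s t] q_pos[of t] by (simp add: w_eq)

text \<open>This is where the doubling condition enters; it makes \<open>\<phi>(s) / s\<close> integrable at \<open>0\<close>.\<close>

lemma phi_div_k:
  assumes "0 < t"
  shows "\<phi> (t / k) \<le> \<phi> t / 2"
proof -
  have "2 * ennreal (q t) = ennreal (2 * q t)"
    using q_pos[OF assms] by (simp add: ennreal_mult)
  \<comment> \<open>The right-hand side is k/t, which is also \<open>P (q (t / k))\<close>;
    monotonicity of \<open>P\<close> then compares the arguments.\<close>
  then have "\<Phi> (ennreal (2 * q t)) \<le> ennreal k * \<Phi> (ennreal (q t))"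
    using doubling[of "ennreal (q t)"] q_pos[OF assms] by simp
  then have "ennreal (P (2 * q t)) \<le> ennreal (k * P (q t))"
    using k_gt_1 P_nonneg by (simp add: Phi_eq_P ennreal_mult)
  then have "P (2 * q t) \<le> P (q (t / k))"
    using assms k_gt_1 P_nonneg by (simp add: P_q ennreal_le_iff)
  then have "2 * q t \<le> q (t / k)"
    using assms k_gt_1 q_pos[of t] q_pos[of "t / k"] P_le_iff by simp
  then have "1 / q (t / k) \<le> 1 / (2 * q t)"
    using assms q_pos[of t] by (intro frac_le) auto
  then show ?thesis using assms k_gt_1 by (simp add: \<phi>_def)
qed

lemma phi_div_k_pow: "0 < t \<Longrightarrow> \<phi> (t / k ^ n) \<le> \<phi> t / 2 ^ n"
proof (induction n)
  case (Suc n)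
  have "\<phi> (t / k ^ n / k) \<le> \<phi> (t / k ^ n) / 2"
    using Suc.prems k_gt_1 by (intro phi_div_k) auto
  also have "\<dots> \<le> \<phi> t / 2 ^ n / 2"
    using Suc by (intro divide_right_mono) auto
  finally show ?case by (simp add: ac_simps)
qed simp

text \<open>The argument is extended because superlevel sets may have infinite measure. The
  indicator restricts the integral to \<open>s\<close> below \<open>x\<close>; negative
  \<open>s\<close> contribute nothing since \<open>w\<close> vanishes there.\<close>

definition W :: "ennreal \<Rightarrow> ennreal" where
  "W x = (\<integral>\<^sup>+s. ennreal (w s) * indicator {ennreal s<..} x \<partial>lborel)"

lemma borel_measurable_W_comp [measurable]:
  assumes [measurable]: "f \<in> borel_measurable M"
  shows "(\<lambda>a. W (f a)) \<in> borel_measurable M"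
proof -
  have "(\<lambda>a. W (f a)) = (\<lambda>a. \<integral>\<^sup>+s. ennreal (w (snd (a, s))) *
      indicator {z. ennreal (fst z) < snd z} (snd (a, s), f (fst (a, s))) \<partial>lborel)"
    unfolding W_def by (intro ext nn_integral_cong) (simp add: indicator_def)
  also have "\<dots> \<in> borel_measurable M"
    by measurable
  finally show ?thesis .
qed

lemma W_mono: "x \<le> y \<Longrightarrow> W x \<le> W y"
  unfolding W_def by (intro nn_integral_mono) (auto simp: indicator_def)

lemma W_0 [simp]: "W 0 = 0"
  by (simp add: W_def)

text \<open>As \<open>w\<close> decreases, its integral over \<open>(0, t)\<close> is at least
  \<open>t * w t\<close>, which is \<open>\<phi> t\<close>.\<close>

lemma phi_le_W:
  assumes "0 < t"
  shows "ennreal (\<phi> t) \<le> W (ennreal t)"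
proof -
  have "ennreal (\<phi> t) = ennreal (w t) * ennreal t"
    using assms w_nonneg[of t] by (simp add: w_def flip: ennreal_mult)
  also have "\<dots> = (\<integral>\<^sup>+s. ennreal (w t) * indicator {0<..<t} s \<partial>lborel)"
    using assms by (subst nn_integral_cmult_indicator) auto
  also have "\<dots> \<le> W (ennreal t)"
    unfolding W_def using w_antimono[of _ t]
    by (intro nn_integral_mono) (auto simp: indicator_def ennreal_less_iff intro!: ennreal_leI)
  finally show ?thesis .
qed

text \<open>On the block from \<open>t / k ^ Suc n\<close> to \<open>t / k ^ n\<close> the weight is
  at most its value at the left end. Enlarging the block to \<open>(0, t / k ^ n]\<close> costs only
  a constant and bounds its share by \<open>k * \<phi> (t / k ^ Suc n)\<close>, which decays like a
  power of 1/2.\<close>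

lemma W_le_phi:
  assumes "0 < t"
  shows "W (ennreal t) \<le> ennreal (k * \<phi> t)"
proof -
  have k0: "0 < k" using k_gt_1 by simp
  have pointwise: "ennreal (w s) * indicator {ennreal s<..} (ennreal t) \<le>
      (\<Sum>n. ennreal (w (t / k ^ Suc n)) * indicator {0<..t / k ^ n} s)" for s
  proof (cases "0 < s \<and> s < t")
    case True
    obtain n0 where "t / s < k ^ n0"
      using real_arch_pow[OF k_gt_1] by blast
    then have ex: "\<exists>n. t / s < k ^ n" by blast
    \<comment> \<open>\<open>m\<close> is the first index with \<open>t / k ^ m < s\<close>; it is
      not 0 because \<open>s < t\<close>, so \<open>s\<close> lies in the block with index
      \<open>m - 1\<close>.\<close>
    define m where "m = (LEAST n. t / s < k ^ n)"
    have m: "t / s < k ^ m" unfolding m_def using ex by (rule LeastI_ex)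
    have "m \<noteq> 0"
    proof
      assume "m = 0"
      then show False using m True by simp
    qed
    then obtain n where n: "m = Suc n" by (cases m) auto
    have "\<not> t / s < k ^ n"
      using n not_less_Least[of n "\<lambda>n. t / s < k ^ n"] by (simp add: m_def)
    then have sn: "s \<le> t / k ^ n" "t / k ^ Suc n < s"
      using m n True k0 by (auto simp: field_simps)
    have "w s \<le> w (t / k ^ Suc n)"
      using sn(2) assms k0 by (intro w_antimono) auto
    then have "ennreal (w s) * indicator {ennreal s<..} (ennreal t) \<le>
        ennreal (w (t / k ^ Suc n)) * indicator {0<..t / k ^ n} s"
      using True sn(1) by (simp add: ennreal_leI ennreal_less_iff)
    also have "\<dots> \<le> (\<Sum>n. ennreal (w (t / k ^ Suc n)) * indicator {0<..t / k ^ n} s)"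
      by (rule term_le_suminf)
    finally show ?thesis .
  next
    case False
    then show ?thesis by (cases "0 < s") (auto simp: indicator_def ennreal_less_iff)
  qed
  have "W (ennreal t) \<le> (\<integral>\<^sup>+s. (\<Sum>n. ennreal (w (t / k ^ Suc n)) * indicator {0<..t / k ^ n} s) \<partial>lborel)"
    unfolding W_def by (intro nn_integral_mono pointwise)
  also have "\<dots> = (\<Sum>n. \<integral>\<^sup>+s. ennreal (w (t / k ^ Suc n)) * indicator {0<..t / k ^ n} s \<partial>lborel)"
    by (rule nn_integral_suminf) measurable
  also have "\<dots> \<le> (\<Sum>n. ennreal (k * \<phi> t * (1 / 2) ^ Suc n))"
  proof (intro suminf_le allI)
    fix n
    have "(\<integral>\<^sup>+s. ennreal (w (t / k ^ Suc n)) * indicator {0<..t / k ^ n} s \<partial>lborel) =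
        ennreal (w (t / k ^ Suc n)) * ennreal (t / k ^ n)"
      using assms k0 by (subst nn_integral_cmult_indicator) auto
    also have "\<dots> = ennreal (k * \<phi> (t / k ^ Suc n))"
    proof -
      have "w (t / k ^ Suc n) * (t / k ^ n) = k * \<phi> (t / k ^ Suc n)"
        using assms k0 by (simp add: w_def field_simps)
      then show ?thesis
        using assms k0 w_nonneg by (simp del: power_Suc flip: ennreal_mult)
    qed
    also have "\<dots> \<le> ennreal (k * \<phi> t * (1 / 2) ^ Suc n)"
      using phi_div_k_pow[OF assms, of "Suc n"] k0
      by (intro ennreal_leI) (simp add: field_simps)
    finally show "(\<integral>\<^sup>+s. ennreal (w (t / k ^ Suc n)) * indicator {0<..t / k ^ n} s \<partial>lborel) \<le>
      ennreal (k * \<phi> t * (1 / 2) ^ Suc n)" .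
  qed auto
  \<comment> \<open>The powers of 1/2 start at exponent 1 and sum to 1, so the constant is exactly
    \<open>k\<close>.\<close>
  also have "\<dots> = ennreal (k * \<phi> t)"
  proof (rule suminf_ennreal_eq)
    show "(\<lambda>n. k * \<phi> t * (1 / 2) ^ Suc n) sums (k * \<phi> t)"
      using sums_mult[OF power_half_series, of "k * \<phi> t"] by simp
    show "0 \<le> k * \<phi> t * (1 / 2) ^ Suc n" for n
      using k0 phi_pos[OF assms] by simp
  qed
  finally show ?thesis .
qed

lemma W_finite: "x < \<infinity> \<Longrightarrow> W x < \<infinity>"
proof -
  assume "x < \<infinity>"
  then obtain r where "x = ennreal r" "0 \<le> r" by (cases x) auto
  then show ?thesis
    using W_le_phi[of r] by (cases "r = 0") (auto intro: le_less_trans)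
qed

text \<open>\<open>W\<close> dominates the unbounded \<open>\<phi>\<close>: for small
  \<open>x\<close>, the choice \<open>t = 1 / P x\<close> gives \<open>q t \<le> x\<close> and so
  \<open>\<phi> t \<ge> 1 / x\<close>.\<close>

lemma W_top: "W \<infinity> = \<infinity>"
proof (rule ccontr)
  assume "W \<infinity> \<noteq> \<infinity>"
  then obtain r where r: "W \<infinity> = ennreal r" "0 \<le> r" by (cases "W \<infinity>") auto
  define x where "x = 1 / (r + 1)"
  have x: "0 < x" using r by (simp add: x_def)
  define t where "t = 1 / P x"
  have t: "0 < t" using P_pos[OF x] by (simp add: t_def)
  have "\<not> x < q t"
    using q_less_iff[OF t x] by (simp add: t_def)
  then have "r + 1 \<le> \<phi> t"
    using q_pos[OF t] r by (simp add: \<phi>_def t x_def field_simps)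
  moreover have "ennreal (\<phi> t) \<le> ennreal r"
    using order_trans[OF phi_le_W[OF t] W_mono[of "ennreal t" \<infinity>]] r by simp
  ultimately show False using r ennreal_le_iff[of r "\<phi> t"] by simp
qed

text \<open>By \<open>W_le_phi\<close> it suffices that \<open>\<phi>\<close> is small near 0, that
  is, that \<open>q\<close> is large there.\<close>

lemma W_tendsto_0:
  assumes "(x \<longlongrightarrow> 0) F"
  shows "((\<lambda>n. W (x n)) \<longlongrightarrow> 0) F"
proof (rule order_tendstoI)
  fix e :: ennreal assume e: "0 < e"
  have "\<exists>e'. 0 < e' \<and> ennreal e' \<le> e"
    using e by (cases e) (auto intro: exI[of _ 1])
  then obtain e' where e': "0 < e'" "ennreal e' \<le> e" by auto
  \<comment> \<open>\<open>q t > y\<close> will give \<open>k * \<phi> t < k / y = e' / 2\<close>;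
    the extra factor 1/2 in \<open>t\<close> makes \<open>P y < 1 / t\<close> strict.\<close>
  define y where "y = 2 * k / e'"
  have y: "0 < y" using e' k_gt_1 by (simp add: y_def)
  define t where "t = 1 / P y / 2"
  have t: "0 < t" using P_pos[OF y] by (simp add: t_def)
  have "y < q t"
    using q_less_iff[OF t y] P_pos[OF y] by (simp add: t_def field_simps)
  then have "k * \<phi> t < e'"
    using y e' k_gt_1 t q_pos[OF t] by (simp add: \<phi>_def y_def field_simps)
  then have "ennreal (k * \<phi> t) < ennreal e'"
    using e' by (intro ennreal_lessI)
  then have Wt: "W (ennreal t) < e"
    using W_le_phi[OF t] e'(2) by (meson le_less_trans less_le_trans)
  have "\<forall>\<^sub>F n in F. x n < ennreal t"
    using assms t by (intro order_tendstoD) auto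
  then show "\<forall>\<^sub>F n in F. W (x n) < e"
  proof eventually_elim
    case (elim n)
    then show ?case using W_mono[of "x n" "ennreal t"] Wt by (meson le_less_trans less_imp_le)
  qed
qed simp

section \<open>Two formulas for the norm: by the rearrangement and by the distribution
  function\<close>

lemma LPhi1_norm_eq_weight:
  "LPhi1_norm \<Phi> f = (\<integral>\<^sup>+s. ennreal (w s) * rearrangement f s \<partial>lborel)"
  unfolding LPhi1_norm_def
proof (intro nn_integral_cong)
  fix s :: real
  show "inverse (gen_inverse \<Phi> (ennreal (1 / s))) * rearrangement f s * ennreal (1 / s) * indicator {0<..} s
    = ennreal (w s) * rearrangement f s"
  proof (cases "0 < s")
    case True
    have "ennreal (w s) = ennreal (inverse (q s)) * ennreal (1 / s)"
      using True q_pos[OF True] by (simp add: w_def \<phi>_def field_simps flip: ennreal_mult)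
    then show ?thesis
      using True q_pos[OF True] by (simp add: gen_inverse_q inverse_ennreal ac_simps)
  qed simp
qed

text \<open>Fubini's theorem on the region where \<open>s\<close> lies below
  \<open>distr_fun f a\<close>. Distribution functions are easier to control than rearrangements
  under domination, scaling and limits.\<close>

lemma LPhi1_norm_eq:
  fixes f :: "real ^ 'n \<Rightarrow> complex"
  assumes [measurable]: "f \<in> borel_measurable lebesgue"
  shows "LPhi1_norm \<Phi> f = (\<integral>\<^sup>+a\<in>{0<..}. W (distr_fun f a) \<partial>lborel)"
proof -
  let ?K = "\<lambda>s a. ennreal (w s) * (indicator {z. ennreal (fst z) < distr_fun f (snd z)} (s, a) * indicator {0<..} a)"
  have "LPhi1_norm \<Phi> f = (\<integral>\<^sup>+s. (\<integral>\<^sup>+a. ?K s a \<partial>lborel) \<partial>lborel)"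
    unfolding LPhi1_norm_eq_weight
    by (subst rearrangement_eq[OF assms], intro nn_integral_cong)
      (subst nn_integral_cmult[symmetric], measurable, auto intro!: nn_integral_cong simp: indicator_def)
  also have "\<dots> = (\<integral>\<^sup>+a. (\<integral>\<^sup>+s. ?K s a \<partial>lborel) \<partial>lborel)"
    by (rule lborel_pair.Fubini') measurable
  also have "\<dots> = (\<integral>\<^sup>+a\<in>{0<..}. W (distr_fun f a) \<partial>lborel)"
    unfolding W_def
    by (intro nn_integral_cong, subst nn_integral_multc[symmetric], measurable)
      (auto intro!: nn_integral_cong simp: indicator_def)
  finally show ?thesis .
qed

section \<open>The Lorentz-type norm and its dual\<close>

lemma LPhi1_norm_mono:
  fixes f F :: "real ^ 'n \<Rightarrow> complex"
  assumes [measurable]: "f \<in> borel_measurable lebesgue" "F \<in> borel_measurable lebesgue"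
    and "\<And>x. cmod (f x) \<le> cmod (F x)"
  shows "LPhi1_norm \<Phi> f \<le> LPhi1_norm \<Phi> F"
proof -
  have "distr_fun f a \<le> distr_fun F a" for a
    unfolding distr_fun_def
    by (intro emeasure_mono) (auto intro: less_le_trans[OF _ assms(3)])
  then show ?thesis
    by (simp add: LPhi1_norm_eq) (intro nn_integral_mono mult_right_mono W_mono, auto)
qed

lemma LPhi1_norm_scale:
  fixes f :: "real ^ 'n \<Rightarrow> complex"
  assumes [measurable]: "f \<in> borel_measurable lebesgue"
  shows "LPhi1_norm \<Phi> (\<lambda>x. c * f x) = ennreal (cmod c) * LPhi1_norm \<Phi> f"
proof (cases "c = 0")
  case True
  then show ?thesis
    by (simp add: LPhi1_norm_eq distr_fun_def) (simp add: nn_integral_0_iff_AE indicator_def)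
next
  case False
  then have c: "0 < cmod c" by simp
  have d: "distr_fun (\<lambda>x. c * f x) (cmod c * a) = distr_fun f a" for a
    unfolding distr_fun_def using c by (simp add: norm_mult)
  have "LPhi1_norm \<Phi> (\<lambda>x. c * f x) =
      ennreal \<bar>cmod c\<bar> * (\<integral>\<^sup>+a. W (distr_fun (\<lambda>x. c * f x) (0 + cmod c * a)) * indicator {0<..} (0 + cmod c * a) \<partial>lborel)"
    unfolding LPhi1_norm_eq[OF borel_measurable_times[OF borel_measurable_const assms]]
    using c by (intro nn_integral_real_affine) auto
  also have "\<dots> = ennreal (cmod c) * LPhi1_norm \<Phi> f"
    using c by (simp add: LPhi1_norm_eq d zero_less_mult_iff indicator_def)
  finally show ?thesis .
qed

lemma LPhi1_measurable: "f \<in> LPhi1 \<Phi> \<Longrightarrow> f \<in> borel_measurable lebesgue"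
  by (simp add: LPhi1_def)

lemma LPhi1_scale: "f \<in> LPhi1 \<Phi> \<Longrightarrow> (\<lambda>x. c * f x) \<in> LPhi1 \<Phi>"
  by (auto simp: LPhi1_def LPhi1_norm_scale ennreal_mult_less_top)

lemma LPhi1_dominated:
  assumes "f \<in> borel_measurable lebesgue" "F \<in> LPhi1 \<Phi>" "\<And>x. cmod (f x) \<le> B * cmod (F x)"
  shows "f \<in> LPhi1 \<Phi>"
proof -
  have "cmod (f x) \<le> cmod (complex_of_real B * F x)" for x
    using assms(3)[of x] by (simp add: norm_mult) (meson abs_ge_self mult_right_mono norm_ge_zero order_trans)
  then have "LPhi1_norm \<Phi> f \<le> LPhi1_norm \<Phi> (\<lambda>x. complex_of_real B * F x)"
    using assms(1) LPhi1_measurable[OF LPhi1_scale[OF assms(2)]] by (intro LPhi1_norm_mono)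
  then show ?thesis
    using assms(1) LPhi1_scale[OF assms(2), of "complex_of_real B"]
    by (auto simp: LPhi1_def)
qed

text \<open>An infinite value at \<open>a\<close> persists at all lower levels, where
  \<open>W \<infinity> = \<infinity>\<close> makes the norm infinite.\<close>

lemma distr_fun_finite:
  assumes "F \<in> LPhi1 \<Phi>" "0 < a"
  shows "distr_fun F a < \<infinity>"
proof (rule ccontr)
  assume "\<not> distr_fun F a < \<infinity>"
  then have top: "distr_fun F a = \<infinity>" by (auto simp: not_less top_unique)
  note [measurable] = LPhi1_measurable[OF assms(1)]
  have "distr_fun F b = \<infinity>" if "b \<le> a" for b
    using distr_fun_antimono[OF LPhi1_measurable[OF assms(1)] that] top by (simp add: top_unique)
  then have "(\<integral>\<^sup>+b. \<infinity> * indicator {0<..a} b \<partial>lborel) \<le> LPhi1_norm \<Phi> F"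
    unfolding LPhi1_norm_eq[OF LPhi1_measurable[OF assms(1)]]
    using W_top by (intro nn_integral_mono) (auto simp: indicator_def)
  moreover have "(\<integral>\<^sup>+b. \<infinity> * indicator {0<..a} b \<partial>lborel) = \<infinity>"
    using assms(2) by (subst nn_integral_cmult_indicator) (auto simp: ennreal_top_mult)
  ultimately show False
    using assms(1) by (auto simp: LPhi1_def top_unique)
qed

text \<open>Dominated convergence is used twice: in \<open>x\<close> at each level
  \<open>a > 0\<close>, where the superlevel set of \<open>F\<close> has finite measure, and then in
  \<open>a\<close>, where finiteness of the norm of \<open>F\<close> supplies the bound.
  \<open>W_tendsto_0\<close> links the two.\<close>

lemma LPhi1_dominated_convergence:
  fixes f :: "nat \<Rightarrow> real ^ 'n \<Rightarrow> complex"
  assumes f [measurable]: "\<And>n. f n \<in> borel_measurable lebesgue" and F: "F \<in> LPhi1 \<Phi>"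
    and le: "\<And>n x. cmod (f n x) \<le> cmod (F x)" and lim: "\<And>x. (\<lambda>n. f n x) \<longlonglongrightarrow> 0"
  shows "(\<lambda>n. LPhi1_norm \<Phi> (f n)) \<longlonglongrightarrow> 0"
proof -
  note Fm [measurable] = LPhi1_measurable[OF F]
  have dle: "distr_fun (f n) a \<le> distr_fun F a" for n a
    unfolding distr_fun_def
    by (intro emeasure_mono) (auto intro: less_le_trans[OF _ le])
  have dlim: "(\<lambda>n. distr_fun (f n) a) \<longlonglongrightarrow> 0" if a: "0 < a" for a
  proof -
    have ind: "distr_fun h a = (\<integral>\<^sup>+x. indicator {x. a < cmod (h x)} x \<partial>lebesgue)"
      if [measurable]: "h \<in> borel_measurable lebesgue" for h :: "real ^ 'n \<Rightarrow> complex"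
      unfolding distr_fun_def by (rule nn_integral_indicator[symmetric]) measurable
    have "(\<lambda>n. \<integral>\<^sup>+x. indicator {x. a < cmod (f n x)} x \<partial>lebesgue) \<longlonglongrightarrow>
        (\<integral>\<^sup>+x. 0 \<partial>(lebesgue :: (real ^ 'n) measure))"
    proof (rule nn_integral_dominated_convergence)
      show "(\<integral>\<^sup>+x. indicator {x. a < cmod (F x)} x \<partial>lebesgue) < \<infinity>"
        using distr_fun_finite[OF F a] ind[OF Fm] by simp
      show "AE x in lebesgue. indicator {x. a < cmod (f n x)} x \<le> (indicator {x. a < cmod (F x)} x :: ennreal)" for n
        using le[of n] by (auto simp: indicator_def intro: less_le_trans)
      show "AE x in lebesgue. (\<lambda>n. indicator {x. a < cmod (f n x)} x) \<longlonglongrightarrow> (0::ennreal)"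
      proof (rule AE_I2)
        fix x
        have "(\<lambda>n. cmod (f n x)) \<longlonglongrightarrow> 0"
          using lim[of x] by (rule tendsto_norm_zero)
        then have "\<forall>\<^sub>F n in sequentially. cmod (f n x) < a"
          using a by (intro order_tendstoD)
        then show "(\<lambda>n. indicator {x. a < cmod (f n x)} x) \<longlonglongrightarrow> (0::ennreal)"
          by (intro tendsto_eventually) (auto elim!: eventually_mono)
      qed
    qed measurable
    then show ?thesis by (simp add: ind[OF f])
  qed
  have "(\<lambda>n. \<integral>\<^sup>+a\<in>{0<..}. W (distr_fun (f n) a) \<partial>lborel) \<longlonglongrightarrow> (\<integral>\<^sup>+a. 0 \<partial>(lborel :: real measure))"
  proof (rule nn_integral_dominated_convergence)
    show "(\<integral>\<^sup>+a\<in>{0<..}. W (distr_fun F a) \<partial>lborel) < \<infinity>"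
      using F by (simp add: LPhi1_def LPhi1_norm_eq)
    show "AE a in lborel. W (distr_fun (f n) a) * indicator {0<..} a \<le> W (distr_fun F a) * indicator {0<..} a" for n
      by (intro AE_I2 mult_right_mono W_mono dle) auto
    show "AE a in lborel. (\<lambda>n. W (distr_fun (f n) a) * indicator {0<..} a) \<longlonglongrightarrow> 0"
    proof (rule AE_I2)
      fix a :: real
      show "(\<lambda>n. W (distr_fun (f n) a) * indicator {0<..} a) \<longlonglongrightarrow> 0"
        using W_tendsto_0[OF dlim[of a]] by (cases "0 < a") auto
    qed
  qed measurable
  then show ?thesis
    by (simp add: LPhi1_norm_eq)
qed

text \<open>Superlevel sets of \<open>f\<close> are empty from level 1 on and lie in
  \<open>E\<close> below it, so the level integral has length at most 1.\<close>

lemma LPhi1_norm_le_W: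
  fixes f :: "real ^ 'n \<Rightarrow> complex"
  assumes [measurable]: "f \<in> borel_measurable lebesgue" "E \<in> sets lebesgue"
    and "\<And>x. cmod (f x) \<le> indicator E x"
  shows "LPhi1_norm \<Phi> f \<le> W (emeasure lebesgue E)"
proof -
  have "W (distr_fun f a) \<le> W (emeasure lebesgue E) * indicator {..<1} a" if "0 < a" for a
  proof (cases "a < 1")
    case True
    have "{x. a < cmod (f x)} \<subseteq> E"
    proof
      fix x assume "x \<in> {x. a < cmod (f x)}"
      then show "x \<in> E"
        using assms(3)[of x] that by (cases "x \<in> E") auto
    qed
    then show ?thesis
      using True by (auto simp: distr_fun_def intro!: W_mono emeasure_mono)
  next
    case False
    have "\<not> a < cmod (f x)" for x
      using assms(3)[of x] False by (cases "x \<in> E") auto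
    then show ?thesis by (simp add: distr_fun_def)
  qed
  then have "LPhi1_norm \<Phi> f \<le> (\<integral>\<^sup>+a. W (emeasure lebesgue E) * indicator {0<..<1} (a::real) \<partial>lborel)"
    unfolding LPhi1_norm_eq[OF assms(1)]
    by (intro nn_integral_mono) (force simp: indicator_def)
  also have "\<dots> = W (emeasure lebesgue E)"
    by (subst nn_integral_cmult_indicator) auto
  finally show ?thesis .
qed

section \<open>Bounded functionals: norm inequality and continuity\<close>

lemma
  assumes "T \<in> LPhi1_dual \<Phi>"
  shows dual_norm_finite: "dual_norm \<Phi> T < \<infinity>"
    and dual_AE_cong: "f \<in> LPhi1 \<Phi> \<Longrightarrow> h \<in> LPhi1 \<Phi> \<Longrightarrow> (AE x in lebesgue. f x = h x) \<Longrightarrow> T f = T h"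
    and dual_add: "f \<in> LPhi1 \<Phi> \<Longrightarrow> h \<in> LPhi1 \<Phi> \<Longrightarrow> T (\<lambda>x. f x + h x) = T f + T h"
    and dual_scale: "f \<in> LPhi1 \<Phi> \<Longrightarrow> T (\<lambda>x. c * f x) = c * T f"
  using assms unfolding LPhi1_dual_def LPhi1_linear_functional_def by blast+

lemma dual_bound:
  fixes f :: "real ^ 'n \<Rightarrow> complex"
  assumes T: "T \<in> LPhi1_dual \<Phi>" and f: "f \<in> LPhi1 \<Phi>"
  shows "ennreal (cmod (T f)) \<le> dual_norm \<Phi> T * LPhi1_norm \<Phi> f"
proof -
  have scale: "T (\<lambda>x. c * f x) = c * T f" for c
    using T f by (rule dual_scale)
  obtain N where N: "dual_norm \<Phi> T = ennreal N" "0 \<le> N"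
    using dual_norm_finite[OF T] by (cases "dual_norm \<Phi> T") auto
  obtain r where r: "LPhi1_norm \<Phi> f = ennreal r" "0 \<le> r"
    using f by (cases "LPhi1_norm \<Phi> f") (auto simp: LPhi1_def)
  have le: "c * cmod (T f) \<le> N" if "0 \<le> c" "c * r \<le> 1" for c
  proof -
    have "LPhi1_norm \<Phi> (\<lambda>x. complex_of_real c * f x) = ennreal (c * r)"
      using that r LPhi1_norm_scale[OF LPhi1_measurable[OF f], of "complex_of_real c"]
      by (simp add: ennreal_mult)
    then have "ennreal (cmod (T (\<lambda>x. complex_of_real c * f x))) \<le> dual_norm \<Phi> T"
      unfolding dual_norm_def using that LPhi1_scale[OF f]
      by (intro SUP_upper) auto
    then show ?thesis
      using that N by (simp add: scale norm_mult)
  qed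
  have "cmod (T f) \<le> N * r"
  proof (cases "r = 0")
    \<comment> \<open>If the norm of \<open>f\<close> vanishes, all multiples of \<open>f\<close>
      lie in the unit ball; the chosen one would force \<open>N + 1 \<le> N\<close>.\<close>
    case True
    have "cmod (T f) = 0"
    proof (rule ccontr)
      assume "cmod (T f) \<noteq> 0"
      then show False
        using le[of "(N + 1) / cmod (T f)"] True N by simp
    qed
    then show ?thesis using True by simp
  next
    case False
    then show ?thesis using le[of "1 / r"] r by (simp add: field_simps)
  qed
  then show ?thesis
    using N r by (simp flip: ennreal_mult)
qed

lemma dual_tendsto_0:
  fixes f :: "nat \<Rightarrow> real ^ 'n \<Rightarrow> complex"
  assumes T: "T \<in> LPhi1_dual \<Phi>"
    and f: "\<And>n. f n \<in> borel_measurable lebesgue" and F: "F \<in> LPhi1 \<Phi>"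
    and le: "\<And>n x. cmod (f n x) \<le> cmod (F x)" and lim: "\<And>x. (\<lambda>n. f n x) \<longlonglongrightarrow> 0"
  shows "(\<lambda>n. T (f n)) \<longlonglongrightarrow> 0"
proof -
  have fL: "f n \<in> LPhi1 \<Phi>" for n
    using LPhi1_dominated[OF f F, of _ 1] le by simp
  have "(\<lambda>n. dual_norm \<Phi> T * LPhi1_norm \<Phi> (f n)) \<longlonglongrightarrow> dual_norm \<Phi> T * 0"
    using dual_norm_finite[OF T]
    by (intro tendsto_mult_ennreal tendsto_const LPhi1_dominated_convergence[OF f F le lim]) auto
  then have up: "(\<lambda>n. dual_norm \<Phi> T * LPhi1_norm \<Phi> (f n)) \<longlonglongrightarrow> ennreal 0"
    by simp
  have "(\<lambda>n. ennreal (cmod (T (f n)))) \<longlonglongrightarrow> ennreal 0"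
  proof (rule tendsto_sandwich[OF _ _ tendsto_const up])
    show "\<forall>\<^sub>F n in sequentially. ennreal 0 \<le> ennreal (cmod (T (f n)))"
      by simp
    show "\<forall>\<^sub>F n in sequentially. ennreal (cmod (T (f n))) \<le> dual_norm \<Phi> T * LPhi1_norm \<Phi> (f n)"
      using dual_bound[OF T fL] by (intro always_eventually allI)
  qed
  then have "(\<lambda>n. cmod (T (f n))) \<longlonglongrightarrow> 0"
    by (subst (asm) tendsto_ennreal_iff) auto
  then show ?thesis
    by (rule tendsto_norm_zero_cancel)
qed

text \<open>A radial step function with value \<open>c n\<close> on the shell where the norm of
  \<open>x\<close> has integer part \<open>n\<close>. The values decrease so fast that the level
  integral is dominated by the convergent sum of \<open>b n * c n\<close>.\<close>

lemma positive_LPhi1: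
  obtains p :: "real ^ 'n \<Rightarrow> real"
  where "p \<in> borel_measurable lebesgue" "\<And>x. 0 < p x" "(\<lambda>x. complex_of_real (p x)) \<in> LPhi1 \<Phi>"
proof -
  define B where "B n = ball (0 :: real ^ 'n) (real (Suc n))" for n
  have "emeasure lebesgue (B n) < \<infinity>" for n
    using emeasure_lborel_ball_finite[of "0 :: real ^ 'n" "real (Suc n)"]
    by (simp add: B_def emeasure_completion)
  then have WB: "W (emeasure lebesgue (B n)) < \<infinity>" for n
    by (rule W_finite)
  define b where "b n = enn2real (W (emeasure lebesgue (B n)))" for n
  have b: "ennreal (b n) = W (emeasure lebesgue (B n))" "0 \<le> b n" for n
    using WB[of n] by (auto simp: b_def)
  \<comment> \<open>The denominator gives \<open>b n * c n \<le> (1 / 2) ^ n\<close> even when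
    \<open>b n\<close> is small, and the power makes \<open>c n\<close> tend to 0.\<close>
  define c where "c n = (1 / 2) ^ n / (1 + b n)" for n
  have b_mono: "b m \<le> b n" if "m \<le> n" for m n
  proof -
    have "W (emeasure lebesgue (B m)) \<le> W (emeasure lebesgue (B n))"
      using that by (intro W_mono emeasure_mono) (auto simp: B_def)
    then show ?thesis using b by (metis ennreal_le_iff)
  qed
  have c_pos: "0 < c n" for n
    using b(2)[of n] by (simp add: c_def)
  have c_anti: "c n \<le> c m" if "m \<le> n" for m n
    unfolding c_def using that b_mono[OF that] b(2)[of m]
    by (intro frac_le power_decreasing) auto
  have c_le: "c n \<le> (1 / 2) ^ n" for n
    unfolding c_def using b(2)[of n] frac_le[of "(1 / 2) ^ n" "(1 / 2) ^ n" 1 "1 + b n"] by simp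
  define p where "p x = c (nat \<lfloor>norm x\<rfloor>)" for x :: "real ^ 'n"
  have p_meas [measurable]: "p \<in> borel_measurable lebesgue"
  proof -
    have "p \<in> borel_measurable borel" unfolding p_def by measurable
    then show ?thesis by (simp add: measurable_completion)
  qed
  have pc_meas [measurable]: "(\<lambda>x. complex_of_real (p x)) \<in> borel_measurable lebesgue"
    by measurable
  have "W (distr_fun (\<lambda>x. complex_of_real (p x)) a) * indicator {0<..} a
      \<le> (\<Sum>n. ennreal (b n) * indicator {0<..<c n} a)" for a
  proof (cases "0 < a \<and> a < c 0")
    case True
    have "(\<lambda>n. (1 / 2 :: real) ^ n) \<longlonglongrightarrow> 0"
      by (rule LIMSEQ_power_zero) simp
    then have "\<forall>\<^sub>F n in sequentially. (1 / 2 :: real) ^ n < a"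
      using True by (intro order_tendstoD) auto
    then obtain m where "(1 / 2 :: real) ^ m < a"
      by (auto simp: eventually_sequentially)
    then have ex: "\<exists>m. c m \<le> a" using c_le[of m] by (intro exI[of _ m]) simp
    \<comment> \<open>With \<open>m = Suc n\<close>, a point where \<open>p\<close> exceeds
      \<open>a\<close> has norm below \<open>n + 1\<close>, which is the radius of
      \<open>B n\<close>; hence the shift in the definition of \<open>B\<close>.\<close>
    define m where "m = (LEAST m. c m \<le> a)"
    have m: "c m \<le> a" unfolding m_def using ex by (rule LeastI_ex)
    have "m \<noteq> 0" using m True by (metis not_le)
    then obtain n where n: "m = Suc n" by (cases m) auto
    then have cn: "a < c n"
      using not_less_Least[of n "\<lambda>m. c m \<le> a"] by (simp add: m_def)
    have "{x. a < cmod (complex_of_real (p x))} \<subseteq> B n"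
    proof safe
      fix x assume "a < cmod (complex_of_real (p x))"
      then have "a < c (nat \<lfloor>norm x\<rfloor>)"
        using c_pos by (simp add: p_def less_imp_le)
      then have "nat \<lfloor>norm x\<rfloor> < m"
        using m c_anti[of m "nat \<lfloor>norm x\<rfloor>"] by force
      then have "norm x < real m" by linarith
      then show "x \<in> B n" by (simp add: B_def n)
    qed
    then have "W (distr_fun (\<lambda>x. complex_of_real (p x)) a) \<le> ennreal (b n) * indicator {0<..<c n} a"
      unfolding distr_fun_def b using cn True
      by (auto intro!: W_mono emeasure_mono simp: B_def)
    also have "\<dots> \<le> (\<Sum>n. ennreal (b n) * indicator {0<..<c n} a)"
      by (rule term_le_suminf)
    finally show ?thesis using True by simp
  next
    case False
    have "\<not> a < cmod (complex_of_real (p x))" if "0 < a" for x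
      using c_anti[of 0 "nat \<lfloor>norm x\<rfloor>"] False that c_pos by (simp add: p_def less_imp_le)
    then show ?thesis by (cases "0 < a") (auto simp: distr_fun_def)
  qed
  then have "LPhi1_norm \<Phi> (\<lambda>x. complex_of_real (p x)) \<le>
     (\<integral>\<^sup>+a. (\<Sum>n. ennreal (b n) * indicator {0<..<c n} a) \<partial>lborel)"
    unfolding LPhi1_norm_eq[OF pc_meas] by (intro nn_integral_mono)
  also have "\<dots> = (\<Sum>n. \<integral>\<^sup>+a. ennreal (b n) * indicator {0<..<c n} a \<partial>lborel)"
    by (rule nn_integral_suminf) measurable
  also have "\<dots> \<le> (\<Sum>n. ennreal ((1 / 2) ^ n))"
  proof (intro suminf_le allI)
    fix n
    have "(\<integral>\<^sup>+a. ennreal (b n) * indicator {0<..<c n} a \<partial>lborel) = ennreal (b n * c n)"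
      using c_pos[of n] b(2)[of n] by (subst nn_integral_cmult_indicator) (auto simp: ennreal_mult)
    also have "\<dots> \<le> ennreal ((1 / 2) ^ n)"
    proof (rule ennreal_leI)
      have "b n * c n = (1 / 2) ^ n * (b n / (1 + b n))"
        by (simp add: c_def)
      also have "\<dots> \<le> (1 / 2) ^ n * 1"
        using b(2)[of n] by (intro mult_left_mono) auto
      finally show "b n * c n \<le> (1 / 2) ^ n" by simp
    qed
    finally show "(\<integral>\<^sup>+a. ennreal (b n) * indicator {0<..<c n} a \<partial>lborel) \<le> ennreal ((1 / 2) ^ n)" .
  qed auto
  also have "\<dots> = ennreal 2"
    by (rule suminf_ennreal_eq) (use geometric_sums[of "1 / 2 :: real"] in auto)
  also have "\<dots> < \<infinity>" by simp
  finally show thesis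
    using c_pos pc_meas by (intro that[of p]) (auto simp: LPhi1_def p_def[symmetric], simp add: p_def)
qed

section \<open>Densities of functionals\<close>

lemma bounded_mult_LPhi1:
  assumes "p \<in> LPhi1 \<Phi>" "u \<in> borel_measurable lebesgue" "\<And>x. cmod (u x) \<le> B"
  shows "(\<lambda>x. p x * u x) \<in> LPhi1 \<Phi>"
proof (rule LPhi1_dominated[OF _ assms(1)])
  show "(\<lambda>x. p x * u x) \<in> borel_measurable lebesgue"
    using LPhi1_measurable[OF assms(1)] assms(2) by measurable
  show "cmod (p x * u x) \<le> B * cmod (p x)" for x
    using mult_right_mono[OF assms(3)[of x] norm_ge_zero[of "p x"]]
    by (simp add: norm_mult mult.commute)
qed

lemma indicator_mult_LPhi1:
  assumes "p \<in> LPhi1 \<Phi>" "A \<in> sets lebesgue"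
  shows "(\<lambda>x. p x * indicator A x) \<in> LPhi1 \<Phi>"
  using assms by (intro bounded_mult_LPhi1[where B = 1]) (auto simp: indicator_def)

text \<open>The set function is bounded by the dual norm of \<open>T\<close> times the norm of
  \<open>p\<close>. It is countably additive because \<open>T\<close> tends to 0 along
  \<open>p\<close> restricted to the remainders. Real and imaginary parts get their densities
  separately.\<close>

lemma dual_density_sets:
  fixes T :: "(real ^ 'n \<Rightarrow> complex) \<Rightarrow> complex"
  assumes T: "T \<in> LPhi1_dual \<Phi>" and p: "p \<in> LPhi1 \<Phi>"
  obtains h where "integrable lebesgue h"
    "\<And>A. A \<in> sets lebesgue \<Longrightarrow> T (\<lambda>x. p x * indicator A x) = (\<integral>x. indicator A x * h x \<partial>lebesgue)"
proof -
  define \<nu> where "\<nu> A = T (\<lambda>x. p x * indicator A x)" for A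
  note pm [measurable] = LPhi1_measurable[OF p]
  have Un: "\<nu> (A \<union> B) = \<nu> A + \<nu> B"
    if "A \<in> sets lebesgue" "B \<in> sets lebesgue" "A \<inter> B = {}" for A B
  proof -
    have "(\<lambda>x. p x * indicator (A \<union> B) x) = (\<lambda>x. p x * indicator A x + p x * indicator B x)"
      using that(3) by (auto simp: indicator_def fun_eq_iff)
    then show ?thesis
      unfolding \<nu>_def using that by (simp add: dual_add[OF T] indicator_mult_LPhi1[OF p])
  qed
  have null: "\<nu> A = 0" if "A \<in> null_sets lebesgue" for A
  proof -
    have A: "A \<in> sets lebesgue" using that by auto
    \<comment> \<open>The zero function is written as \<open>0 * p\<close> so that homogeneity
      evaluates \<open>T\<close> on it.\<close>
    have "AE x in lebesgue. p x * indicator A x = 0 * p x"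
      using AE_not_in[OF that] by eventually_elim simp
    then have "\<nu> A = T (\<lambda>x. 0 * p x)"
      unfolding \<nu>_def by (intro dual_AE_cong[OF T] indicator_mult_LPhi1[OF p] A LPhi1_scale[OF p])
    also have "\<dots> = 0 * T p" by (rule dual_scale[OF T p])
    finally show ?thesis by simp
  qed
  have sums: "(\<lambda>i. \<nu> (A i)) sums \<nu> (\<Union>i. A i)"
    if A: "range A \<subseteq> sets lebesgue" "disjoint_family A" for A
  proof -
    have Am: "A i \<in> sets lebesgue" for i using A by auto
    have fin: "\<nu> (\<Union>i<n. A i) = (\<Sum>i<n. \<nu> (A i))" for n
    proof (induction n)
      case 0
      show ?case using null[of "{}"] by simp
    next
      case (Suc n)
      have "(\<Union>i<Suc n. A i) = (\<Union>i<n. A i) \<union> A n"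
        by (auto simp: less_Suc_eq)
      moreover have "(\<Union>i<n. A i) \<inter> A n = {}"
        using disjoint_family_onD[OF A(2), of _ n] by (auto simp: less_le) (metis IntI empty_iff)
      moreover have "(\<Union>i<n. A i) \<in> sets lebesgue"
        using Am by (intro sets.finite_UN) auto
      ultimately show ?case
        using Suc Un[of "\<Union>i<n. A i" "A n"] Am by simp
    qed
    \<comment> \<open>The remainders shrink to the empty set: a point of \<open>A j\<close> has left
      \<open>R n\<close> once \<open>n > j\<close>.\<close>
    define R where "R n = (\<Union>i. A i) - (\<Union>i<n. A i)" for n :: nat
    have Um: "(\<Union>i. A i) \<in> sets lebesgue" "(\<Union>i<n. A i) \<in> sets lebesgue" for n :: nat
      using Am by (auto intro!: sets.finite_UN)
    then have Rm: "R n \<in> sets lebesgue" for n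
      unfolding R_def by (intro sets.Diff)
    have UR: "\<nu> (\<Union>i. A i) = \<nu> (\<Union>i<n. A i) + \<nu> (R n)" for n
    proof -
      have "(\<Union>i<n. A i) \<union> R n = (\<Union>i. A i)" by (auto simp: R_def)
      then show ?thesis using Un[OF Um(2)[of n] Rm[of n]] by (auto simp: R_def)
    qed
    have eq: "(\<Sum>i<n. \<nu> (A i)) = \<nu> (\<Union>i. A i) - \<nu> (R n)" for n
      unfolding UR[of n] fin by simp
    have "(\<lambda>n. T (\<lambda>x. p x * indicator (R n) x)) \<longlonglongrightarrow> 0"
    proof (rule dual_tendsto_0[OF T _ p])
      show "(\<lambda>x. p x * indicator (R n) x) \<in> borel_measurable lebesgue" for n
        using indicator_mult_LPhi1[OF p Rm] by (rule LPhi1_measurable)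
      show "cmod (p x * indicator (R n) x) \<le> cmod (p x)" for n x
        by (simp add: indicator_def)
      show "(\<lambda>n. p x * indicator (R n) x) \<longlonglongrightarrow> 0" for x
      proof (cases "x \<in> (\<Union>i. A i)")
        case True
        then obtain j where "x \<in> A j" by auto
        then have "x \<notin> R n" if "Suc j \<le> n" for n
          using that by (auto simp: R_def Suc_le_eq)
        then show ?thesis
          by (intro tendsto_eventually) (auto simp: eventually_sequentially intro!: exI[of _ "Suc j"])
      qed (simp add: R_def)
    qed
    then have "(\<lambda>n. \<nu> (\<Union>i. A i) - \<nu> (R n)) \<longlonglongrightarrow> \<nu> (\<Union>i. A i) - 0"
      unfolding \<nu>_def[of "R _"] by (intro tendsto_diff tendsto_const)
    then show ?thesis
      unfolding sums_def eq by simp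
  qed
  define K where "K = enn2real (dual_norm \<Phi> T * LPhi1_norm \<Phi> p)"
  have K: "cmod (\<nu> A) \<le> K" if A: "A \<in> sets lebesgue" for A
  proof -
    have fin: "dual_norm \<Phi> T * LPhi1_norm \<Phi> p < \<infinity>"
      using dual_norm_finite[OF T] p by (auto simp: LPhi1_def ennreal_mult_less_top)
    have "LPhi1_norm \<Phi> (\<lambda>x. p x * indicator A x) \<le> LPhi1_norm \<Phi> p"
      by (rule LPhi1_norm_mono[OF LPhi1_measurable[OF indicator_mult_LPhi1[OF p A]] pm])
        (simp add: indicator_def)
    then have "ennreal (cmod (\<nu> A)) \<le> dual_norm \<Phi> T * LPhi1_norm \<Phi> p"
      unfolding \<nu>_def
      by (intro order_trans[OF dual_bound[OF T indicator_mult_LPhi1[OF p A]]] mult_left_mono) auto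
    also have "\<dots> = ennreal K" using fin by (simp add: K_def)
    finally show ?thesis by (simp add: K_def)
  qed
  obtain h1 where h1: "integrable lebesgue h1"
    "\<And>A. A \<in> sets lebesgue \<Longrightarrow> Re (\<nu> A) = (\<integral>x. indicator A x * h1 x \<partial>lebesgue)"
  proof (rule signed_Radon_Nikodym[OF sigma_finite_lebesgue, of "\<lambda>A. Re (\<nu> A)" K])
    show "\<bar>Re (\<nu> A)\<bar> \<le> K" if "A \<in> sets lebesgue" for A
      using K[OF that] abs_Re_le_cmod[of "\<nu> A"] by simp
  qed (use sums null in \<open>auto intro: sums_Re\<close>)
  obtain h2 where h2: "integrable lebesgue h2"
    "\<And>A. A \<in> sets lebesgue \<Longrightarrow> Im (\<nu> A) = (\<integral>x. indicator A x * h2 x \<partial>lebesgue)"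
  proof (rule signed_Radon_Nikodym[OF sigma_finite_lebesgue, of "\<lambda>A. Im (\<nu> A)" K])
    show "\<bar>Im (\<nu> A)\<bar> \<le> K" if "A \<in> sets lebesgue" for A
      using K[OF that] abs_Im_le_cmod[of "\<nu> A"] by simp
  qed (use sums null in \<open>auto intro: sums_Im\<close>)
  define h where "h x = complex_of_real (h1 x) + \<i> * complex_of_real (h2 x)" for x
  have int: "integrable lebesgue h"
    unfolding h_def using h1(1) h2(1) by (intro Bochner_Integration.integrable_add integrable_mult_right integrable_of_real)
  have "\<nu> A = (\<integral>x. indicator A x * h x \<partial>lebesgue)" if A: "A \<in> sets lebesgue" for A
  proof -
    have i: "integrable lebesgue (\<lambda>x. indicator A x * h1 x)" "integrable lebesgue (\<lambda>x. indicator A x * h2 x)"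
      using integrable_mult_indicator[OF A h1(1)] integrable_mult_indicator[OF A h2(1)] by auto
    have "(\<integral>x. indicator A x * h x \<partial>lebesgue) =
      (\<integral>x. complex_of_real (indicator A x * h1 x) + \<i> * complex_of_real (indicator A x * h2 x) \<partial>lebesgue)"
      by (intro Bochner_Integration.integral_cong) (auto simp: h_def indicator_def)
    also have "\<dots> = complex_of_real (Re (\<nu> A)) + \<i> * complex_of_real (Im (\<nu> A))"
      using i by (subst Bochner_Integration.integral_add)
        (auto simp: h1(2)[OF A] h2(2)[OF A] simp del: of_real_mult)
    also have "\<dots> = \<nu> A" by (rule complex_eq[symmetric])
    finally show ?thesis ..
  qed
  then show thesis
    using int by (intro that[of h]) (auto simp: \<nu>_def)
qed

text \<open>Linearity extends the formula from indicators to simple functions. Bounded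
  \<open>u\<close> are pointwise limits of these; \<open>T\<close> converges by domination with a
  multiple of \<open>p\<close>, the integrals by domination with a multiple of
  \<open>h\<close>.\<close>

lemma dual_density:
  fixes T :: "(real ^ 'n \<Rightarrow> complex) \<Rightarrow> complex"
  assumes T: "T \<in> LPhi1_dual \<Phi>" and p: "p \<in> LPhi1 \<Phi>"
  obtains h where "integrable lebesgue h"
    "\<And>u B. u \<in> borel_measurable lebesgue \<Longrightarrow> (\<And>x. cmod (u x) \<le> B) \<Longrightarrow>
       T (\<lambda>x. p x * u x) = (\<integral>x. u x * h x \<partial>lebesgue)"
proof -
  obtain h where h: "integrable lebesgue h"
    and hA: "\<And>A. A \<in> sets lebesgue \<Longrightarrow> T (\<lambda>x. p x * indicator A x) = (\<integral>x. indicator A x * h x \<partial>lebesgue)"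
    using dual_density_sets[OF T p] by metis
  note [measurable] = LPhi1_measurable[OF p] borel_measurable_integrable[OF h]
  have uh: "integrable lebesgue (\<lambda>x. u x * h x)"
    if u: "u \<in> borel_measurable lebesgue" and "\<And>x. cmod (u x) \<le> B" for u B
  proof (rule Bochner_Integration.integrable_bound)
    show "integrable lebesgue (\<lambda>x. complex_of_real B * h x)"
      using h by simp
    show "(\<lambda>x. u x * h x) \<in> borel_measurable lebesgue" using u by measurable
    show "AE x in lebesgue. cmod (u x * h x) \<le> cmod (complex_of_real B * h x)"
      using that(2) by (intro AE_I2) (auto simp: norm_mult intro!: mult_right_mono order_trans[OF that(2)])
  qed
  have simple: "T (\<lambda>x. p x * u x) = (\<integral>x. u x * h x \<partial>lebesgue)" if u: "simple_function lebesgue u" for u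
  proof -
    have um [measurable]: "u \<in> borel_measurable lebesgue"
      using u by (rule borel_measurable_simple_function)
    have fin: "finite (range u)" using u by (simp add: simple_function_def)
    have A: "u -` {y} \<in> sets lebesgue" for y
      using simple_functionD(2)[OF u, of "{y}"] by simp
    have I: "S \<subseteq> range u \<Longrightarrow> T (\<lambda>x. p x * (\<Sum>y\<in>S. y * indicator (u -` {y}) x)) =
        (\<integral>x. (\<Sum>y\<in>S. y * indicator (u -` {y}) x) * h x \<partial>lebesgue)"
      if "finite S" for S
      using that
    proof (induction S)
      case empty
      show ?case using dual_scale[OF T p, of 0] by simp
    next
      case (insert y S)
      let ?s = "\<lambda>x. \<Sum>y\<in>S. y * indicator (u -` {y}) x"
      have sm: "?s \<in> borel_measurable lebesgue"
        using A by (intro borel_measurable_sum borel_measurable_times borel_measurable_const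
            borel_measurable_indicator)
      have sb: "cmod (?s x) \<le> (\<Sum>y\<in>S. cmod y)" for x
        by (intro sum_norm_le) (auto simp: indicator_def)
      let ?i = "indicator (u -` {y}) :: _ \<Rightarrow> complex"
      have sum: "(\<Sum>y\<in>insert y S. y * indicator (u -` {y}) x) = y * ?i x + ?s x" for x
        by (rule sum.insert[OF insert.hyps])
      have ih: "T (\<lambda>x. p x * ?s x) = (\<integral>x. ?s x * h x \<partial>lebesgue)"
        using insert.prems by (intro insert.IH) auto
      have ii: "integrable lebesgue (\<lambda>x. y * (?i x * h x))"
        using A by (intro integrable_mult_right uh[where B = 1]) (auto simp: indicator_def)
      have "T (\<lambda>x. p x * (y * ?i x + ?s x)) = T (\<lambda>x. y * (p x * ?i x) + p x * ?s x)"
        by (simp only: distrib_left mult.left_commute)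
      also have "\<dots> = y * T (\<lambda>x. p x * ?i x) + T (\<lambda>x. p x * ?s x)"
        by (simp only: dual_add[OF T LPhi1_scale[OF indicator_mult_LPhi1[OF p A]] bounded_mult_LPhi1[OF p sm sb]]
            dual_scale[OF T indicator_mult_LPhi1[OF p A]])
      also have "\<dots> = (\<integral>x. y * (?i x * h x) \<partial>lebesgue) + (\<integral>x. ?s x * h x \<partial>lebesgue)"
        unfolding ih hA[OF A] by simp
      also have "\<dots> = (\<integral>x. y * (?i x * h x) + ?s x * h x \<partial>lebesgue)"
        by (rule Bochner_Integration.integral_add[OF ii uh[OF sm sb], symmetric])
      finally have "T (\<lambda>x. p x * (y * ?i x + ?s x)) = (\<integral>x. (y * ?i x + ?s x) * h x \<partial>lebesgue)"
        by (simp only: distrib_right mult.assoc)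
      then show ?case
        unfolding sum .
    qed
    have "(\<Sum>y\<in>range u. y * indicator (u -` {y}) x) = u x" for x
    proof -
      have "(\<Sum>y\<in>range u. y * indicator (u -` {y}) x) = (\<Sum>y\<in>range u. if y = u x then y else 0)"
        by (intro sum.cong) (auto simp: indicator_def)
      then show ?thesis using fin by simp
    qed
    then show ?thesis using I[OF fin order_refl] by (simp only:)
  qed
  have "T (\<lambda>x. p x * u x) = (\<integral>x. u x * h x \<partial>lebesgue)"
    if u [measurable]: "u \<in> borel_measurable lebesgue" and B: "\<And>x. cmod (u x) \<le> B" for u B
  proof -
    obtain s where s: "\<And>i. simple_function lebesgue (s i)"
      "\<And>x. (\<lambda>i. s i x) \<longlonglongrightarrow> u x" "\<And>i x. cmod (s i x) \<le> 2 * cmod (u x)"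
      using borel_measurable_implies_sequence_metric[OF u, of 0] by auto
    have sm [measurable]: "s i \<in> borel_measurable lebesgue" for i
      using s(1) by (rule borel_measurable_simple_function)
    have sB: "cmod (s i x) \<le> 2 * B" for i x
      using s(3)[of i x] B[of x] by simp
    have d: "T (\<lambda>x. p x * (u x - s i x)) = T (\<lambda>x. p x * u x) - T (\<lambda>x. p x * s i x)" for i
    proof -
      have "T (\<lambda>x. p x * (u x - s i x)) = T (\<lambda>x. p x * u x + (- 1) * (p x * s i x))"
        by (simp add: algebra_simps)
      also have "\<dots> = T (\<lambda>x. p x * u x) + (- 1) * T (\<lambda>x. p x * s i x)"
        using bounded_mult_LPhi1[OF p sm sB] bounded_mult_LPhi1[OF p u B]
        by (simp only: dual_add[OF T] dual_scale[OF T] LPhi1_scale)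
      finally show ?thesis by simp
    qed
    have "(\<lambda>i. T (\<lambda>x. p x * (u x - s i x))) \<longlonglongrightarrow> 0"
    proof (rule dual_tendsto_0[OF T _ LPhi1_scale[OF p, of "complex_of_real (3 * B)"]])
      \<comment> \<open>\<open>3 * B\<close> collects \<open>B\<close> for \<open>u\<close> and
        \<open>2 * B\<close> for the approximants.\<close>
      show "cmod (p x * (u x - s n x)) \<le> cmod (complex_of_real (3 * B) * p x)" for n x
      proof -
        have "cmod (u x - s n x) \<le> \<bar>3 * B\<bar>"
          using norm_triangle_ineq4[of "u x" "s n x"] B[of x] sB[of n x] by simp
        then show ?thesis by (simp add: norm_mult mult.commute mult_left_mono)
      qed
      show "(\<lambda>n. p x * (u x - s n x)) \<longlonglongrightarrow> 0" for x
        using tendsto_mult[OF tendsto_const[of "p x"] tendsto_diff[OF tendsto_const[of "u x"] s(2)[of x]]]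
        by simp
    qed measurable
    then have "(\<lambda>i. T (\<lambda>x. p x * u x) - (T (\<lambda>x. p x * u x) - T (\<lambda>x. p x * s i x))) \<longlonglongrightarrow> T (\<lambda>x. p x * u x) - 0"
      unfolding d by (intro tendsto_diff tendsto_const)
    then have "(\<lambda>i. T (\<lambda>x. p x * s i x)) \<longlonglongrightarrow> T (\<lambda>x. p x * u x)"
      by simp
    moreover have "(\<lambda>i. \<integral>x. s i x * h x \<partial>lebesgue) \<longlonglongrightarrow> (\<integral>x. u x * h x \<partial>lebesgue)"
    proof (rule integral_dominated_convergence)
      show "integrable lebesgue (\<lambda>x. 2 * B * cmod (h x))"
        using h by simp
      show "AE x in lebesgue. (\<lambda>i. s i x * h x) \<longlonglongrightarrow> u x * h x"
        using s(2) by (intro AE_I2 tendsto_mult tendsto_const)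
      show "AE x in lebesgue. cmod (s i x * h x) \<le> 2 * B * cmod (h x)" for i
        using sB by (intro AE_I2) (simp add: norm_mult mult_right_mono)
    qed measurable
    ultimately show ?thesis
      unfolding simple[OF s(1)] by (rule LIMSEQ_unique)
  qed
  then show thesis using h by (intro that[of h]) blast+
qed

section \<open>Duality\<close>

text \<open>The supremum is tested at \<open>q s\<close>: the product is 2/s and
  \<open>\<Phi>\<close> takes away 1/s. The factor 2 is what leaves 1/s over.\<close>

lemma complementary_ge:
  assumes "0 < s"
  shows "ennreal (1 / s) \<le> complementary \<Phi> (ennreal (2 * w s))"
proof -
  have "2 * w s * q s = 2 / s"
    using assms q_pos[OF assms] by (simp add: w_def \<phi>_def)
  then have "ennreal (2 * w s) * ennreal (q s) = ennreal (2 / s)"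
    using q_pos[OF assms] w_nonneg[of s] by (simp flip: ennreal_mult)
  then have "ennreal (1 / s) = ennreal (2 * w s) * ennreal (q s) - \<Phi> (ennreal (q s))"
    using assms by (simp add: Phi_eq_P P_q ennreal_minus flip: diff_divide_distrib)
  also have "\<dots> \<le> complementary \<Phi> (ennreal (2 * w s))"
    unfolding complementary_def by (auto intro!: SUP_upper)
  finally show ?thesis .
qed

text \<open>For \<open>r \<le> q \<tau>\<close> the product \<open>t * r\<close> is already at most
  \<open>w \<tau> * q \<tau>\<close>, that is \<open>1 / \<tau>\<close>. Beyond
  \<open>q \<tau>\<close> the chord slope of \<open>P\<close> is at least \<open>w \<tau>\<close>,
  hence at least \<open>t\<close>, so the difference is not positive.\<close>

lemma complementary_le:
  assumes "0 < \<tau>" "0 \<le> t" "t \<le> w \<tau>"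
  shows "complementary \<Phi> (ennreal t) \<le> ennreal (1 / \<tau>)"
proof -
  have "ennreal t * s - \<Phi> s \<le> ennreal (1 / \<tau>)" if fin: "s < \<infinity>" for s
  proof -
    obtain r where r: "s = ennreal r" "0 \<le> r" using fin by (cases s) auto
    note q = q_pos[OF assms(1)]
    have "t * r - P r \<le> 1 / \<tau>"
    proof (cases "r \<le> q \<tau>")
      case True
      have "t * r \<le> w \<tau> * q \<tau>" using True assms r by (intro mult_mono) auto
      also have "\<dots> = 1 / \<tau>" using assms q by (simp add: w_def \<phi>_def)
      finally show ?thesis using P_nonneg[of r] by simp
    next
      case False
      have "t \<le> P r / r"
        using P_slope_mono[of "q \<tau>" r] q False w_eq[OF assms(1)] assms by simp
      then have "t * r \<le> P r" using False q by (simp add: field_simps)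
      moreover have "0 \<le> 1 / \<tau>" using assms by simp
      ultimately show ?thesis by linarith
    qed
    then show ?thesis
      using r assms P_nonneg by (simp add: Phi_eq_P ennreal_minus ennreal_leI flip: ennreal_mult)
  qed
  then show ?thesis
    unfolding complementary_def by (auto intro!: SUP_least)
qed

text \<open>Growth at least linear under dilation, since \<open>M \<ge> 1\<close> only enlarges the
  subtracted term. It serves to trade a finite modular for a modular at most 1.\<close>

lemma complementary_scale:
  assumes "1 \<le> M"
  shows "ennreal M * complementary \<Phi> (ennreal t) \<le> complementary \<Phi> (ennreal M * ennreal t)"
proof -
  have "ennreal M * (ennreal t * s - \<Phi> s) \<le> (ennreal M * ennreal t) * s - \<Phi> s" for s
  proof -
    have "1 * \<Phi> s \<le> ennreal M * \<Phi> s"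
      using assms by (intro mult_right_mono) auto
    then have "ennreal M * (ennreal t * s) - ennreal M * \<Phi> s \<le> ennreal M * (ennreal t * s) - \<Phi> s"
      by (intro ennreal_minus_mono) auto
    then show ?thesis
      by (simp add: ennreal_right_diff_distrib mult.assoc)
  qed
  then have "(SUP s\<in>{s. s < \<infinity>}. ennreal M * (ennreal t * s - \<Phi> s)) \<le>
      (SUP s\<in>{s. s < \<infinity>}. (ennreal M * ennreal t) * s - \<Phi> s)"
    by (intro SUP_mono) auto
  then show ?thesis
    by (simp add: complementary_def SUP_mult_left_ennreal ennreal_mult_eq_top_iff)
qed

text \<open>Dividing by an extra \<open>M\<close> moves the level from \<open>t\<close> to
  \<open>M * t\<close>, where the complementary function has gained the factor \<open>M\<close>;
  this absorbs the bound \<open>m\<close>. The maximum with 1 is required by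
  \<open>complementary_scale\<close>.\<close>

lemma wL_weak_modular_le_1:
  fixes g :: "real ^ 'n \<Rightarrow> complex"
  assumes "g \<in> wL (complementary \<Phi>)"
  obtains l where "0 < l" "weak_modular (complementary \<Phi>) (\<lambda>x. g x / complex_of_real l) \<le> 1"
proof -
  obtain \<kappa> where \<kappa>: "0 < \<kappa>" "weak_modular (complementary \<Phi>) (\<lambda>x. complex_of_real \<kappa> * g x) < \<infinity>"
    using assms by (auto simp: wL_def)
  then obtain m where m: "weak_modular (complementary \<Phi>) (\<lambda>x. complex_of_real \<kappa> * g x) = ennreal m" "0 \<le> m"
    by (cases "weak_modular (complementary \<Phi>) (\<lambda>x. complex_of_real \<kappa> * g x)") auto
  define M where "M = max 1 m"
  have M: "1 \<le> M" "m \<le> M" by (auto simp: M_def)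
  have "complementary \<Phi> (ennreal t) * distr_fun (\<lambda>x. g x / complex_of_real (M / \<kappa>)) t \<le> 1" if "0 < t" for t
  proof -
    have d: "distr_fun (\<lambda>x. g x / complex_of_real (M / \<kappa>)) t =
        distr_fun (\<lambda>x. complex_of_real \<kappa> * g x) (M * t)"
      unfolding distr_fun_divide[OF divide_pos_pos[OF less_le_trans[OF zero_less_one M(1)] \<kappa>(1)]]
      using \<kappa>(1) by (simp add: distr_fun_def norm_mult field_simps)
    have "ennreal M * (complementary \<Phi> (ennreal t) * distr_fun (\<lambda>x. g x / complex_of_real (M / \<kappa>)) t) \<le>
       complementary \<Phi> (ennreal M * ennreal t) * distr_fun (\<lambda>x. complex_of_real \<kappa> * g x) (M * t)"
      unfolding d mult.assoc[symmetric] by (intro mult_right_mono complementary_scale M) auto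
    also have "\<dots> = complementary \<Phi> (ennreal (M * t)) * distr_fun (\<lambda>x. complex_of_real \<kappa> * g x) (M * t)"
      using M that by (simp add: ennreal_mult)
    also have "\<dots> \<le> weak_modular (complementary \<Phi>) (\<lambda>x. complex_of_real \<kappa> * g x)"
      unfolding weak_modular_def using M that by (intro SUP_upper) auto
    also have "\<dots> \<le> ennreal M * 1"
      using m M by (simp add: ennreal_leI)
    finally show ?thesis
      using M by (subst (asm) ennreal_mult_le_mult_iff) auto
  qed
  then have "weak_modular (complementary \<Phi>) (\<lambda>x. g x / complex_of_real (M / \<kappa>)) \<le> 1"
    unfolding weak_modular_def by (intro SUP_least) auto
  then show thesis
    using M \<kappa> by (intro that[of "M / \<kappa>"]) auto
qed

text \<open>The modular at level \<open>2 * w s\<close> bounds the measure above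
  \<open>2 * l * w s\<close> by \<open>s\<close>, so this level competes in the infimum defining the
  rearrangement.\<close>

lemma rearrangement_le_weight:
  fixes g :: "real ^ 'n \<Rightarrow> complex"
  assumes l: "0 < l" and mod: "weak_modular (complementary \<Phi>) (\<lambda>x. g x / complex_of_real l) \<le> 1"
    and s: "0 < s"
  shows "rearrangement g s \<le> ennreal (2 * l * w s)"
proof -
  have w2: "0 < 2 * w s" using w_pos[OF s] by simp
  have "ennreal (1 / s) * distr_fun g (l * (2 * w s)) \<le>
      complementary \<Phi> (ennreal (2 * w s)) * distr_fun (\<lambda>x. g x / complex_of_real l) (2 * w s)"
    unfolding distr_fun_divide[OF l] by (intro mult_right_mono complementary_ge s) auto
  also have "\<dots> \<le> weak_modular (complementary \<Phi>) (\<lambda>x. g x / complex_of_real l)"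
    unfolding weak_modular_def using w2 by (intro SUP_upper) auto
  also note mod
  finally have "ennreal s * (ennreal (1 / s) * distr_fun g (l * (2 * w s))) \<le> ennreal s * 1"
    by (intro mult_left_mono) auto
  moreover have "ennreal s * ennreal (1 / s) = 1"
    using s by (simp flip: ennreal_mult)
  ultimately have "distr_fun g (2 * l * w s) \<le> ennreal s"
    by (simp add: mult.assoc[symmetric] mult.commute[of l])
  then show ?thesis
    unfolding rearrangement_def using l w_pos[OF s] by (intro INF_lower) auto
qed

lemma nn_integral_mult_le:
  fixes f g :: "real ^ 'n \<Rightarrow> complex"
  assumes f: "f \<in> borel_measurable lebesgue" and g: "g \<in> borel_measurable lebesgue" and l: "0 < l"
    and mod: "weak_modular (complementary \<Phi>) (\<lambda>x. g x / complex_of_real l) \<le> 1"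
  shows "(\<integral>\<^sup>+x. ennreal (cmod (f x * g x)) \<partial>lebesgue) \<le> ennreal (2 * l) * LPhi1_norm \<Phi> f"
proof -
  note [measurable] = f g
  have "rearrangement f s * rearrangement g s * indicator {0<..} s \<le>
      ennreal (2 * l) * (ennreal (w s) * rearrangement f s)" for s
  proof (cases "0 < s")
    case True
    have "rearrangement f s * rearrangement g s \<le> rearrangement f s * ennreal (2 * l * w s)"
      using rearrangement_le_weight[OF l mod True] by (rule mult_left_mono) simp
    also have "\<dots> = ennreal (2 * l) * (ennreal (w s) * rearrangement f s)"
      using l w_nonneg[of s] by (simp add: ennreal_mult ac_simps)
    finally show ?thesis using True by simp
  qed simp
  then have "(\<integral>\<^sup>+s\<in>{0<..}. rearrangement f s * rearrangement g s \<partial>lborel) \<le>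
      (\<integral>\<^sup>+s. ennreal (2 * l) * (ennreal (w s) * rearrangement f s) \<partial>lborel)"
    by (intro nn_integral_mono)
  also have "\<dots> = ennreal (2 * l) * LPhi1_norm \<Phi> f"
    unfolding LPhi1_norm_eq_weight
    by (intro nn_integral_cmult) measurable
  finally show ?thesis
    using Hardy_Littlewood[OF f g] by (rule order_trans[rotated])
qed

section \<open>Functions of weak type as bounded functionals\<close>

lemma wL_integrable:
  assumes "g \<in> wL (complementary \<Phi>)" "f \<in> LPhi1 \<Phi>"
  shows "integrable lebesgue (\<lambda>x. f x * g x)"
proof -
  obtain l where l: "0 < l" "weak_modular (complementary \<Phi>) (\<lambda>x. g x / complex_of_real l) \<le> 1"
    using wL_weak_modular_le_1[OF assms(1)] .
  note [measurable] = wL_measurable[OF assms(1)] LPhi1_measurable[OF assms(2)]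
  have "(\<integral>\<^sup>+x. ennreal (cmod (f x * g x)) \<partial>lebesgue) \<le> ennreal (2 * l) * LPhi1_norm \<Phi> f"
    using l by (intro nn_integral_mult_le) measurable
  also have "\<dots> < \<infinity>"
    using assms(2) by (simp add: LPhi1_def ennreal_mult_less_top)
  finally show ?thesis
    by (intro integrableI_bounded) measurable
qed

lemma dual_norm_int_functional_le:
  fixes g :: "real ^ 'n \<Rightarrow> complex"
  assumes "g \<in> wL (complementary \<Phi>)"
  shows "dual_norm \<Phi> (int_functional g) \<le> ennreal 2 * wL_norm (complementary \<Phi>) g"
proof -
  \<comment> \<open>Moving the 2 to the left lets the infimum on the right be treated member by
    member.\<close>
  have "dual_norm \<Phi> (int_functional g) / ennreal 2 \<le> wL_norm (complementary \<Phi>) g"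
    unfolding wL_norm_def
  proof (rule INF_greatest)
    fix l assume "l \<in> {l. 0 < l \<and> weak_modular (complementary \<Phi>) (\<lambda>x. g x / complex_of_real l) \<le> 1}"
    then have l: "0 < l" "weak_modular (complementary \<Phi>) (\<lambda>x. g x / complex_of_real l) \<le> 1"
      by auto
    have "dual_norm \<Phi> (int_functional g) \<le> ennreal (2 * l)"
      unfolding dual_norm_def
    proof (rule SUP_least)
      fix f :: "real ^ 'n \<Rightarrow> complex" assume "f \<in> {f \<in> LPhi1 \<Phi>. LPhi1_norm \<Phi> f \<le> 1}"
      then have f: "f \<in> LPhi1 \<Phi>" "LPhi1_norm \<Phi> f \<le> 1" by auto
      have "ennreal (cmod (int_functional g f)) \<le> (\<integral>\<^sup>+x. ennreal (cmod (f x * g x)) \<partial>lebesgue)"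
        unfolding int_functional_def by (rule integral_norm_bound_ennreal[OF wL_integrable[OF assms f(1)]])
      also have "\<dots> \<le> ennreal (2 * l) * LPhi1_norm \<Phi> f"
        by (rule nn_integral_mult_le[OF LPhi1_measurable[OF f(1)] wL_measurable[OF assms] l])
      also have "\<dots> \<le> ennreal (2 * l) * 1"
        using f(2) by (intro mult_left_mono) auto
      finally show "ennreal (cmod (int_functional g f)) \<le> ennreal (2 * l)" by simp
    qed
    then have "dual_norm \<Phi> (int_functional g) / ennreal 2 \<le> ennreal (2 * l) / ennreal 2"
      by (rule divide_right_mono_ennreal)
    also have "\<dots> = ennreal l" using l(1) by (subst divide_ennreal) auto
    finally show "dual_norm \<Phi> (int_functional g) / ennreal 2 \<le> ennreal l" .
  qed
  then have "ennreal 2 * (dual_norm \<Phi> (int_functional g) / ennreal 2) \<le> ennreal 2 * wL_norm (complementary \<Phi>) g"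
    by (rule mult_left_mono) simp
  then show ?thesis
    by (subst (asm) ennreal_times_divide, subst (asm) mult.commute, subst (asm) ennreal_mult_divide_eq) auto
qed

lemma int_functional_dual:
  fixes g :: "real ^ 'n \<Rightarrow> complex"
  assumes "g \<in> wL (complementary \<Phi>)"
  shows "int_functional g \<in> LPhi1_dual \<Phi>"
proof -
  note int = wL_integrable[OF assms]
  obtain l where l: "0 < l" "weak_modular (complementary \<Phi>) (\<lambda>x. g x / complex_of_real l) \<le> 1"
    using wL_weak_modular_le_1[OF assms] .
  then have "wL_norm (complementary \<Phi>) g \<le> ennreal l"
    unfolding wL_norm_def by (intro INF_lower) auto
  then have "wL_norm (complementary \<Phi>) g < \<infinity>"
    by (rule le_less_trans) simp
  then have "dual_norm \<Phi> (int_functional g) < \<infinity>"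
    by (intro le_less_trans[OF dual_norm_int_functional_le[OF assms]]) (simp add: ennreal_mult_less_top)
  moreover have "int_functional g f = int_functional g h"
    if "f \<in> LPhi1 \<Phi>" "h \<in> LPhi1 \<Phi>" "AE x in lebesgue. f x = h x" for f h :: "real ^ 'n \<Rightarrow> complex"
    unfolding int_functional_def using int[OF that(1)] int[OF that(2)] that(3)
    by (intro integral_cong_AE borel_measurable_integrable) auto
  moreover have "int_functional g (\<lambda>x. f x + h x) = int_functional g f + int_functional g h"
    if "f \<in> LPhi1 \<Phi>" "h \<in> LPhi1 \<Phi>" for f h :: "real ^ 'n \<Rightarrow> complex"
    unfolding int_functional_def using int[OF that(1)] int[OF that(2)]
    by (simp add: distrib_right)
  moreover have "int_functional g (\<lambda>x. c * f x) = c * int_functional g f" if "f \<in> LPhi1 \<Phi>" for c and f :: "real ^ 'n \<Rightarrow> complex"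
    unfolding int_functional_def using int[OF that] by (simp add: mult.assoc)
  ultimately show ?thesis
    unfolding LPhi1_dual_def LPhi1_linear_functional_def by blast
qed

text \<open>Testing \<open>T\<close> on \<open>p * u = cnj (sgn g)\<close> on a superlevel set \<open>E\<close> of \<open>g\<close> compares
  \<open>\<integral>\<^bsub>E\<^esub> |g|\<close> with \<open>W (|E|)\<close>, the norm of the indicator function of \<open>E\<close>.\<close>

lemma weak_modular_le_1:
  fixes g :: "real ^ 'n \<Rightarrow> complex" and p :: "real ^ 'n \<Rightarrow> real"
  assumes T: "T \<in> LPhi1_dual \<Phi>" and g [measurable]: "g \<in> borel_measurable lebesgue"
    and p: "(\<lambda>x. complex_of_real (p x)) \<in> LPhi1 \<Phi>" and p_pos: "\<And>x. 0 < p x"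
    and int: "integrable lebesgue (\<lambda>x. complex_of_real (p x) * g x)"
    and rep: "\<And>u B. u \<in> borel_measurable lebesgue \<Longrightarrow> (\<And>x. cmod (u x) \<le> B) \<Longrightarrow>
      T (\<lambda>x. complex_of_real (p x) * u x) = (\<integral>x. complex_of_real (p x) * u x * g x \<partial>lebesgue)"
    and l: "0 < l" "ennreal k * dual_norm \<Phi> T \<le> ennreal l"
  shows "weak_modular (complementary \<Phi>) (\<lambda>x. g x / complex_of_real l) \<le> 1"
  unfolding weak_modular_def
proof (rule SUP_least)
  fix t :: real assume "t \<in> {0<..}"
  then have t: "0 < t" by simp
  have k0: "0 < k" using k_gt_1 by simp
  have [measurable]: "p \<in> borel_measurable lebesgue"
  proof -
    note [measurable] = LPhi1_measurable[OF p]
    have "(\<lambda>x. Re (complex_of_real (p x))) \<in> borel_measurable lebesgue" by measurable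
    then show ?thesis by simp
  qed
  obtain N where N: "dual_norm \<Phi> T = ennreal N" "0 \<le> N"
    using dual_norm_finite[OF T] by (cases "dual_norm \<Phi> T") auto
  have kN: "k * N \<le> l"
    using l N k0 by (simp flip: ennreal_mult)
  \<comment> \<open>The cut by \<open>p\<close> gives finite measure, as \<open>p\<close> has finite
    norm, and keeps \<open>1 / p\<close> bounded on \<open>E n\<close>, so that the test function is
    \<open>p\<close> times a bounded function.\<close>
  define E where "E n = {x. l * t < cmod (g x)} \<inter> {x. 1 / real (Suc n) < p x}" for n
  have Em [measurable]: "E n \<in> sets lebesgue" for n
  proof -
    have "{x \<in> space lebesgue. l * t < cmod (g x) \<and> 1 / real (Suc n) < p x} \<in> sets lebesgue"
      by measurable
    then show ?thesis by (simp add: E_def Collect_conj_eq)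
  qed
  have "complementary \<Phi> (ennreal t) * emeasure lebesgue (E n) \<le> 1" for n
  proof -
    have "emeasure lebesgue (E n) \<le> distr_fun (\<lambda>x. complex_of_real (p x)) (1 / real (Suc n))"
      unfolding distr_fun_def E_def
      by (intro emeasure_mono sets_distr_fun LPhi1_measurable[OF p]) auto
    also have "\<dots> < \<infinity>" by (rule distr_fun_finite[OF p]) simp
    finally obtain \<tau> where \<tau>: "emeasure lebesgue (E n) = ennreal \<tau>" "0 \<le> \<tau>"
      by (cases "emeasure lebesgue (E n)") auto
    show ?thesis
    proof (cases "\<tau> = 0")
      \<comment> \<open>On a null set the convention \<open>0 * \<infinity> = 0\<close> matters: the
        complementary function may be infinite at \<open>t\<close>.\<close>
      case True
      then show ?thesis using \<tau> by simp
    next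
      case False
      then have \<tau>0: "0 < \<tau>" using \<tau> by simp
      define u where "u x = indicator (E n) x * cnj (sgn (g x)) / complex_of_real (p x)" for x
      have um: "u \<in> borel_measurable lebesgue"
      proof -
        have [measurable]: "(\<lambda>x. sgn (g x)) \<in> borel_measurable lebesgue"
          unfolding sgn_eq by measurable
        have "(\<lambda>x. cnj (sgn (g x))) \<in> borel_measurable lebesgue"
          by (rule borel_measurable_continuous_on[OF continuous_on_cnj[OF continuous_on_id]]) measurable
        then show ?thesis unfolding u_def by measurable
      qed
      have sgn1: "cmod (sgn z) \<le> 1" for z by (simp add: norm_sgn)
      have ub: "cmod (u x) \<le> real (Suc n)" for x
      proof (cases "x \<in> E n")
        case True
        then have "1 / p x \<le> real (Suc n)"
          using p_pos[of x] by (simp add: E_def field_simps)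
        then show ?thesis
          using True p_pos[of x] sgn1[of "g x"] divide_right_mono[of "cmod (sgn (g x))" 1 "p x"]
          by (simp add: u_def norm_divide)
      qed (simp add: u_def)
      have pu: "complex_of_real (p x) * u x = indicator (E n) x * cnj (sgn (g x))" for x
        using p_pos[of x] by (simp add: u_def)
      have pug: "complex_of_real (p x) * u x * g x = complex_of_real (indicator (E n) x * cmod (g x))" for x
        unfolding pu by (simp add: mult.assoc cnj_sgn_mult indicator_def)
      have "integrable lebesgue (\<lambda>x. complex_of_real (p x) * u x * g x)"
      proof (rule Bochner_Integration.integrable_bound)
        show "integrable lebesgue (\<lambda>x. complex_of_real (real (Suc n)) * (complex_of_real (p x) * g x))"
          using int by (rule integrable_mult_right)
        show "(\<lambda>x. complex_of_real (p x) * u x * g x) \<in> borel_measurable lebesgue"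
          using um by measurable
        show "AE x in lebesgue. cmod (complex_of_real (p x) * u x * g x) \<le>
            cmod (complex_of_real (real (Suc n)) * (complex_of_real (p x) * g x))"
        proof (rule AE_I2)
          fix x
          have "cmod (u x) * cmod (complex_of_real (p x) * g x) \<le>
              real (Suc n) * cmod (complex_of_real (p x) * g x)"
            using ub by (intro mult_right_mono) auto
          then show "cmod (complex_of_real (p x) * u x * g x) \<le>
            cmod (complex_of_real (real (Suc n)) * (complex_of_real (p x) * g x))"
            by (simp add: norm_mult ac_simps del: of_nat_Suc)
        qed
      qed
      then have i: "integrable lebesgue (\<lambda>x. indicator (E n) x * cmod (g x))"
        unfolding pug by (rule integrable_complex_of_realD)
      have "T (\<lambda>x. complex_of_real (p x) * u x) = complex_of_real (\<integral>x. indicator (E n) x * cmod (g x) \<partial>lebesgue)"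
        unfolding rep[OF um ub] pug by (rule integral_complex_of_real)
      then have Tn: "(\<integral>x. indicator (E n) x * cmod (g x) \<partial>lebesgue) \<le> cmod (T (\<lambda>x. complex_of_real (p x) * u x))"
        by simp
      have "ennreal (cmod (T (\<lambda>x. complex_of_real (p x) * u x))) \<le>
          dual_norm \<Phi> T * LPhi1_norm \<Phi> (\<lambda>x. complex_of_real (p x) * u x)"
        by (rule dual_bound[OF T bounded_mult_LPhi1[OF p um ub]])
      also have "\<dots> \<le> dual_norm \<Phi> T * ennreal (k * \<phi> \<tau>)"
      proof (intro mult_left_mono order_trans[OF LPhi1_norm_le_W[OF LPhi1_measurable[OF bounded_mult_LPhi1[OF p um ub]] Em]])
        show "cmod (complex_of_real (p x) * u x) \<le> indicator (E n) x" for x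
          unfolding pu using sgn1 by (simp add: norm_mult indicator_def)
        show "W (emeasure lebesgue (E n)) \<le> ennreal (k * \<phi> \<tau>)"
          unfolding \<tau> by (rule W_le_phi[OF \<tau>0])
      qed simp
      also have "\<dots> = ennreal (k * N * \<phi> \<tau>)"
        using N k0 phi_pos[OF \<tau>0] by (simp add: ac_simps flip: ennreal_mult)
      finally have "cmod (T (\<lambda>x. complex_of_real (p x) * u x)) \<le> k * N * \<phi> \<tau>"
        using N k0 phi_pos[OF \<tau>0] by (subst (asm) ennreal_le_iff) auto
      also have "\<dots> \<le> l * \<phi> \<tau>"
        using kN phi_pos[OF \<tau>0] by (intro mult_right_mono) auto
      finally have up: "(\<integral>x. indicator (E n) x * cmod (g x) \<partial>lebesgue) \<le> l * \<phi> \<tau>"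
        using Tn by simp
      have "(\<integral>x. indicator (E n) x * (l * t) \<partial>lebesgue) \<le> (\<integral>x. indicator (E n) x * cmod (g x) \<partial>lebesgue)"
      proof (rule integral_mono[OF _ i])
        show "integrable lebesgue (\<lambda>x. indicator (E n) x * (l * t))"
          using \<tau> by (intro integrable_mult_left integrable_real_indicator) auto
      qed (auto simp: indicator_def E_def)
      \<comment> \<open>Since the modulus of \<open>g\<close> exceeds \<open>l * t\<close> on
        \<open>E n\<close>, a Chebyshev estimate meets the upper bound; cancelling
        \<open>l * \<tau>\<close> leaves exactly the hypothesis of
        \<open>complementary_le\<close>.\<close>
      then have "\<tau> * (l * t) \<le> l * \<phi> \<tau>"
        using up \<tau> by (simp add: measure_def)
      then have "t \<le> w \<tau>"
        using l \<tau>0 by (simp add: w_def field_simps)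
      then have "complementary \<Phi> (ennreal t) \<le> ennreal (1 / \<tau>)"
        using t \<tau>0 by (intro complementary_le) auto
      then have "complementary \<Phi> (ennreal t) * emeasure lebesgue (E n) \<le> ennreal (1 / \<tau>) * ennreal \<tau>"
        unfolding \<tau> by (rule mult_right_mono) simp
      also have "\<dots> = 1" using \<tau>0 by (simp flip: ennreal_mult)
      finally show ?thesis .
    qed
  qed
  \<comment> \<open>As \<open>p\<close> is positive everywhere, the sets \<open>E n\<close> increase
    to the full superlevel set and the uniform bound passes to it.\<close>
  then have "(SUP n. complementary \<Phi> (ennreal t) * emeasure lebesgue (E n)) \<le> 1"
    by (intro SUP_least)
  then have "complementary \<Phi> (ennreal t) * (SUP n. emeasure lebesgue (E n)) \<le> 1"
    by (simp add: SUP_mult_left_ennreal)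
  moreover have "(SUP n. emeasure lebesgue (E n)) = emeasure lebesgue (\<Union>n. E n)"
  proof (rule SUP_emeasure_incseq)
    show "incseq E"
    proof (rule incseq_SucI)
      fix n
      have "1 / real (Suc (Suc n)) \<le> 1 / real (Suc n)"
        by (intro frac_le) auto
      then show "E n \<le> E (Suc n)"
        unfolding E_def by (intro Int_mono order_refl Collect_mono impI) (rule le_less_trans)
    qed
  qed auto
  moreover have "(\<Union>n. E n) = {x. l * t < cmod (g x)}"
  proof -
    have "\<exists>n. 1 / real (Suc n) < p x" for x
      using reals_Archimedean[OF p_pos[of x]] by (simp add: inverse_eq_divide)
    then show ?thesis by (auto simp: E_def)
  qed
  ultimately show "complementary \<Phi> (ennreal t) * distr_fun (\<lambda>x. g x / complex_of_real l) t \<le> 1"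
    unfolding distr_fun_divide[OF l(1)] by (simp add: distr_fun_def)
qed

text \<open>The modular estimate is applied to the functional of \<open>g\<close> itself. It needs
  \<open>l > 0\<close> while the dual norm may be 0, so the bound is shown for everything strictly
  above the right-hand side and density of the order does the rest.\<close>

lemma wL_norm_le_dual_norm:
  fixes g :: "real ^ 'n \<Rightarrow> complex"
  assumes g: "g \<in> wL (complementary \<Phi>)"
  shows "wL_norm (complementary \<Phi>) g \<le> ennreal k * dual_norm \<Phi> (int_functional g)"
proof -
  obtain p :: "real ^ 'n \<Rightarrow> real" where p: "\<And>x. 0 < p x" "(\<lambda>x. complex_of_real (p x)) \<in> LPhi1 \<Phi>"
    using positive_LPhi1 by metis
  note T = int_functional_dual[OF g]
  have "wL_norm (complementary \<Phi>) g \<le> ennreal l"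
    if "0 < l" "ennreal k * dual_norm \<Phi> (int_functional g) \<le> ennreal l" for l
    unfolding wL_norm_def
    using that weak_modular_le_1[OF T wL_measurable[OF g] p(2) p(1) wL_integrable[OF g p(2)] _ that]
    by (intro INF_lower) (simp add: int_functional_def)
  moreover have "0 < l" "ennreal k * dual_norm \<Phi> (int_functional g) \<le> ennreal l"
    if "ennreal k * dual_norm \<Phi> (int_functional g) < ennreal l" for l
    using that by (auto simp: less_imp_le intro: ccontr simp: ennreal_neg not_less)
  ultimately have "wL_norm (complementary \<Phi>) g \<le> x"
    if "ennreal k * dual_norm \<Phi> (int_functional g) < x" for x
    using that by (cases x) auto
  then show ?thesis by (rule dense_ge)
qed

text \<open>The modular estimate puts \<open>g\<close> into the weak space, so its functional is
  bounded as well. Two bounded functionals that agree on all \<open>p * u\<close> with bounded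
  \<open>u\<close> agree everywhere, because truncations of \<open>f\<close> have this form and both
  functionals vanish in the limit on the rest.\<close>

lemma dual_representation:
  fixes T :: "(real ^ 'n \<Rightarrow> complex) \<Rightarrow> complex"
  assumes T: "T \<in> LPhi1_dual \<Phi>"
  obtains g where "g \<in> wL (complementary \<Phi>)" "\<And>f. f \<in> LPhi1 \<Phi> \<Longrightarrow> T f = int_functional g f"
proof -
  obtain p :: "real ^ 'n \<Rightarrow> real" where [measurable]: "p \<in> borel_measurable lebesgue"
    and p_pos: "\<And>x. 0 < p x" and p: "(\<lambda>x. complex_of_real (p x)) \<in> LPhi1 \<Phi>"
    using positive_LPhi1 by metis
  obtain h where h: "integrable lebesgue h" and
    hT: "\<And>u B. u \<in> borel_measurable lebesgue \<Longrightarrow> (\<And>x. cmod (u x) \<le> B) \<Longrightarrow>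
       T (\<lambda>x. complex_of_real (p x) * u x) = (\<integral>x. u x * h x \<partial>lebesgue)"
    using dual_density[OF T p] by blast
  note [measurable] = borel_measurable_integrable[OF h]
  define g where "g x = h x / complex_of_real (p x)" for x
  have gm [measurable]: "g \<in> borel_measurable lebesgue"
    unfolding g_def by measurable
  have pg: "complex_of_real (p x) * g x = h x" for x
    using p_pos[of x] by (simp add: g_def)
  have rep: "T (\<lambda>x. complex_of_real (p x) * u x) = (\<integral>x. complex_of_real (p x) * u x * g x \<partial>lebesgue)"
    if "u \<in> borel_measurable lebesgue" "\<And>x. cmod (u x) \<le> B" for u B
  proof -
    have eq: "complex_of_real (p x) * u x * g x = u x * h x" for x
      unfolding pg[of x, symmetric] by (simp add: ac_simps)
    show ?thesis unfolding eq by (rule hT[OF that])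
  qed
  obtain N where N: "dual_norm \<Phi> T = ennreal N" "0 \<le> N"
    using dual_norm_finite[OF T] by (cases "dual_norm \<Phi> T") auto
  \<comment> \<open>The summand 1 keeps \<open>l\<close> positive when the dual norm is 0.\<close>
  define l where "l = k * N + 1"
  have l: "0 < l" "ennreal k * dual_norm \<Phi> T \<le> ennreal l"
    using N k_gt_1 by (auto simp: l_def add_nonneg_pos simp flip: ennreal_mult intro!: ennreal_leI)
  have mod: "weak_modular (complementary \<Phi>) (\<lambda>x. g x / complex_of_real l) \<le> 1"
    by (rule weak_modular_le_1[OF T gm p p_pos _ rep l]) (simp add: pg h)
  have gw: "g \<in> wL (complementary \<Phi>)"
    unfolding wL_def using gm l(1) le_less_trans[OF mod, of \<infinity>]
    by (auto intro!: exI[of _ "1 / l"] simp: divide_inverse mult.commute)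
  note S = int_functional_dual[OF gw]
  have "T f = int_functional g f" if f: "f \<in> LPhi1 \<Phi>" for f
  proof -
    note [measurable] = LPhi1_measurable[OF f]
    \<comment> \<open>On \<open>D n\<close> both \<open>f\<close> and \<open>1 / p\<close> are
      bounded, so the truncated \<open>f\<close> is \<open>p * u n\<close> with \<open>u n\<close>
      bounded.\<close>
    define D where "D n = {x. 1 / real (Suc n) < p x \<and> cmod (f x) \<le> real n}" for n
    have Dm [measurable]: "D n \<in> sets lebesgue" for n
    proof -
      have "{x \<in> space lebesgue. 1 / real (Suc n) < p x \<and> cmod (f x) \<le> real n} \<in> sets lebesgue"
        by measurable
      then show ?thesis by (simp add: D_def)
    qed
    define u where "u n x = indicator (D n) x * f x / complex_of_real (p x)" for n x
    have um: "u n \<in> borel_measurable lebesgue" for n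
      unfolding u_def by measurable
    have ub: "cmod (u n x) \<le> real n * real (Suc n)" for n x
    proof (cases "x \<in> D n")
      case True
      then have "1 / p x \<le> real (Suc n)" "cmod (f x) \<le> real n"
        using p_pos[of x] by (auto simp: D_def field_simps)
      then have "cmod (f x) * (1 / p x) \<le> real n * real (Suc n)"
        using p_pos[of x] by (intro mult_mono) auto
      then show ?thesis
        using True p_pos[of x] by (simp add: u_def norm_divide)
    qed (simp add: u_def)
    have pu: "complex_of_real (p x) * u n x = indicator (D n) x * f x" for n x
      using p_pos[of x] by (simp add: u_def)
    have eq: "T (\<lambda>x. f x * indicator (D n) x) = int_functional g (\<lambda>x. f x * indicator (D n) x)" for n
      using rep[OF um ub, of n] unfolding pu int_functional_def by (simp add: ac_simps)
    define R where "R n x = f x * indicator (- D n) x" for n x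
    have Dc: "- D n \<in> sets lebesgue" for n
      using sets.compl_sets[OF Dm[of n]] by (simp add: Compl_eq_Diff_UNIV)
    have RL: "R n \<in> LPhi1 \<Phi>" for n
      unfolding R_def by (rule indicator_mult_LPhi1[OF f Dc])
    have split: "S f = S (\<lambda>x. f x * indicator (D n) x) + S (R n)" if S: "S \<in> LPhi1_dual \<Phi>" for S n
    proof -
      have "f = (\<lambda>x. f x * indicator (D n) x + R n x)"
        by (auto simp: R_def indicator_def)
      then show ?thesis
        using dual_add[OF S indicator_mult_LPhi1[OF f Dm[of n]] RL[of n]] by simp
    qed
    have lim: "(\<lambda>n. S (R n)) \<longlonglongrightarrow> 0" if S: "S \<in> LPhi1_dual \<Phi>" for S
    proof (rule dual_tendsto_0[OF S LPhi1_measurable[OF RL] f])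
      show "cmod (R n x) \<le> cmod (f x)" for n x
        by (simp add: R_def indicator_def)
      show "(\<lambda>n. R n x) \<longlonglongrightarrow> 0" for x
      proof (rule tendsto_eventually)
        obtain n1 where n1: "1 / real (Suc n1) < p x"
          using reals_Archimedean[OF p_pos[of x]] by (auto simp: inverse_eq_divide)
        obtain n2 where n2: "cmod (f x) \<le> real n2"
          using real_arch_simple by blast
        show "\<forall>\<^sub>F n in sequentially. R n x = 0"
          using eventually_ge_at_top[of "max n1 n2"]
        proof eventually_elim
          case (elim n)
          have "1 / real (Suc n) \<le> 1 / real (Suc n1)"
            using elim by (intro frac_le) auto
          then have "x \<in> D n"
            using n1 n2 elim by (auto simp: D_def)
          then show ?case by (simp add: R_def)
        qed
      qed
    qed
    have "T f - int_functional g f = T (R n) - int_functional g (R n)" for n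
      using split[OF T, of n] split[OF S, of n] eq[of n] by simp
    moreover have "(\<lambda>n. T (R n) - int_functional g (R n)) \<longlonglongrightarrow> 0 - 0"
      by (intro tendsto_diff lim T S)
    ultimately have "(\<lambda>n::nat. T f - int_functional g f) \<longlonglongrightarrow> 0"
      by simp
    then show ?thesis
      by (simp add: LIMSEQ_const_iff)
  qed
  then show thesis using gw by (intro that)
qed

text \<open>Testing on \<open>p\<close> times the conjugate phase of \<open>h - g\<close> shows that
  \<open>p\<close> times the modulus of the difference has integral 0, and \<open>p\<close> is
  positive.\<close>

lemma int_functional_unique:
  fixes g h :: "real ^ 'n \<Rightarrow> complex"
  assumes g: "g \<in> wL (complementary \<Phi>)" and h: "h \<in> wL (complementary \<Phi>)"
    and eq: "\<And>f. f \<in> LPhi1 \<Phi> \<Longrightarrow> int_functional g f = int_functional h f"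
  shows "AE x in lebesgue. h x = g x"
proof -
  obtain p :: "real ^ 'n \<Rightarrow> real" where p_pos: "\<And>x. 0 < p x"
    and p: "(\<lambda>x. complex_of_real (p x)) \<in> LPhi1 \<Phi>"
    using positive_LPhi1 by metis
  note [measurable] = wL_measurable[OF g] wL_measurable[OF h]
  define f where "f x = complex_of_real (p x) * cnj (sgn (h x - g x))" for x
  have "(\<lambda>x. cnj (sgn (h x - g x))) \<in> borel_measurable lebesgue"
  proof (rule borel_measurable_continuous_on[OF continuous_on_cnj[OF continuous_on_id]])
    show "(\<lambda>x. sgn (h x - g x)) \<in> borel_measurable lebesgue"
      unfolding sgn_eq by measurable
  qed
  then have f: "f \<in> LPhi1 \<Phi>"
    unfolding f_def by (rule bounded_mult_LPhi1[OF p, where B = 1]) (simp add: norm_sgn)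
  have fg: "f x * h x - f x * g x = complex_of_real (p x * cmod (h x - g x))" for x
    by (simp add: f_def cnj_sgn_mult mult.assoc flip: right_diff_distrib)
  note i = wL_integrable[OF h f] wL_integrable[OF g f]
  have int: "integrable lebesgue (\<lambda>x. p x * cmod (h x - g x))"
    using Bochner_Integration.integrable_diff[OF i] unfolding fg by (rule integrable_complex_of_realD)
  have "complex_of_real (\<integral>x. p x * cmod (h x - g x) \<partial>lebesgue) = int_functional h f - int_functional g f"
    unfolding int_functional_def Bochner_Integration.integral_diff[OF i, symmetric] fg
    by (rule integral_complex_of_real[symmetric])
  also have "\<dots> = 0" using eq[OF f] by simp
  finally have "(\<integral>x. p x * cmod (h x - g x) \<partial>lebesgue) = 0"
    by (simp only: of_real_eq_0_iff)
  then have "AE x in lebesgue. p x * cmod (h x - g x) = 0"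
    by (subst (asm) integral_nonneg_eq_0_iff_AE[OF int]) (auto intro!: AE_I2 mult_nonneg_nonneg less_imp_le[OF p_pos])
  then show ?thesis
  proof eventually_elim
    case (elim x)
    then show ?case using p_pos[of x] by simp
  qed
qed

end

theorem theorem1p5:
  fixes \<Phi> :: "ennreal \<Rightarrow> ennreal"
  assumes "young_function \<Phi>" and "Delta2 \<Phi>"
  shows "(\<forall>g :: real ^ 'n \<Rightarrow> complex. g \<in> wL (complementary \<Phi>) \<longrightarrow>
            (\<forall>f \<in> LPhi1 \<Phi>. integrable lebesgue (\<lambda>x. f x * g x)) \<and>
            int_functional g \<in> LPhi1_dual \<Phi>)
       \<and> (\<forall>T :: (real ^ 'n \<Rightarrow> complex) \<Rightarrow> complex. T \<in> LPhi1_dual \<Phi> \<longrightarrow>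
            (\<exists>g \<in> wL (complementary \<Phi>).
               (\<forall>f \<in> LPhi1 \<Phi>. T f = int_functional g f) \<and>
               (\<forall>h \<in> wL (complementary \<Phi>).
                  (\<forall>f \<in> LPhi1 \<Phi>. T f = int_functional h f) \<longrightarrow> (AE x in lebesgue. h x = g x))))
       \<and> (\<exists>C::real. C \<ge> 1 \<and>
            (\<forall>g :: real ^ 'n \<Rightarrow> complex. g \<in> wL (complementary \<Phi>) \<longrightarrow>
               ennreal (inverse C) * wL_norm (complementary \<Phi>) g \<le> dual_norm \<Phi> (int_functional g) \<and>
               dual_norm \<Phi> (int_functional g) \<le> ennreal C * wL_norm (complementary \<Phi>) g))"
proof -
  obtain k where "1 < k" "\<And>r. 0 < r \<Longrightarrow> \<Phi> (2 * r) \<le> ennreal k * \<Phi> r"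
    using assms(2) unfolding Delta2_def by blast
  then interpret delta2_young \<Phi> k
    using assms(1) by unfold_locales
  show ?thesis
  proof (intro conjI allI impI ballI)
    fix g :: "real ^ 'n \<Rightarrow> complex" assume g: "g \<in> wL (complementary \<Phi>)"
    show "int_functional g \<in> LPhi1_dual \<Phi>" using g by (rule int_functional_dual)
    show "integrable lebesgue (\<lambda>x. f x * g x)" if "f \<in> LPhi1 \<Phi>" for f
      using g that by (rule wL_integrable)
  next
    fix T :: "(real ^ 'n \<Rightarrow> complex) \<Rightarrow> complex" assume "T \<in> LPhi1_dual \<Phi>"
    then obtain g where g: "g \<in> wL (complementary \<Phi>)" "\<And>f. f \<in> LPhi1 \<Phi> \<Longrightarrow> T f = int_functional g f"
      using dual_representation by metis
    show "\<exists>g \<in> wL (complementary \<Phi>). (\<forall>f \<in> LPhi1 \<Phi>. T f = int_functional g f) \<and>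
        (\<forall>h \<in> wL (complementary \<Phi>).
          (\<forall>f \<in> LPhi1 \<Phi>. T f = int_functional h f) \<longrightarrow> (AE x in lebesgue. h x = g x))"
      using g int_functional_unique[OF g(1)] by (intro bexI[of _ g]) auto
  next
    \<comment> \<open>The 2 belongs to the upper bound through \<open>complementary_ge\<close>, the
      \<open>k\<close> to the lower one through \<open>W_le_phi\<close>.\<close>
    define C where "C = max 2 k"
    have C: "0 < C" "2 \<le> C" "k \<le> C" by (auto simp: C_def)
    have "ennreal (inverse C) * wL_norm (complementary \<Phi>) g \<le> dual_norm \<Phi> (int_functional g)"
      "dual_norm \<Phi> (int_functional g) \<le> ennreal C * wL_norm (complementary \<Phi>) g"
      if g: "g \<in> wL (complementary \<Phi>)" for g :: "real ^ 'n \<Rightarrow> complex"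
    proof -
      have "dual_norm \<Phi> (int_functional g) \<le> ennreal 2 * wL_norm (complementary \<Phi>) g"
        using g by (rule dual_norm_int_functional_le)
      also have "\<dots> \<le> ennreal C * wL_norm (complementary \<Phi>) g"
        using C by (intro mult_right_mono ennreal_leI) auto
      finally show "dual_norm \<Phi> (int_functional g) \<le> ennreal C * wL_norm (complementary \<Phi>) g" .
      have "wL_norm (complementary \<Phi>) g \<le> ennreal C * dual_norm \<Phi> (int_functional g)"
        using C by (intro order_trans[OF wL_norm_le_dual_norm[OF g]] mult_right_mono ennreal_leI) auto
      then have "ennreal (inverse C) * wL_norm (complementary \<Phi>) g \<le>
          ennreal (inverse C) * (ennreal C * dual_norm \<Phi> (int_functional g))"
        by (rule mult_left_mono) simp
      also have "\<dots> = dual_norm \<Phi> (int_functional g)"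
        using C by (simp flip: mult.assoc ennreal_mult)
      finally show "ennreal (inverse C) * wL_norm (complementary \<Phi>) g \<le> dual_norm \<Phi> (int_functional g)" .
    qed
    then show "\<exists>C::real. C \<ge> 1 \<and>
        (\<forall>g :: real ^ 'n \<Rightarrow> complex. g \<in> wL (complementary \<Phi>) \<longrightarrow>
           ennreal (inverse C) * wL_norm (complementary \<Phi>) g \<le> dual_norm \<Phi> (int_functional g) \<and>
           dual_norm \<Phi> (int_functional g) \<le> ennreal C * wL_norm (complementary \<Phi>) g)"
      using C by (intro exI[of _ C]) auto
  qed
qed

end
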